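(* Let $n\ge1$, $\sigma\in S_n$ and let $\alpha$ be a weak composition of length $n$. Let $Z_\alpha^\sigma(x_1,\dots,x_n)$ be the partition function of the atom model with data $(\alpha,\sigma)$. Then $$Z_\alpha^\sigma(x_1,\dots,x_n)=\sum_{\beta_{(n)}\lessdot_\sigma\cdots\lessdot_\sigma\beta_{(1)}\lessdot_\sigma\alpha}x_1^{|\alpha|-|\beta_{(1)}|}\,x_2^{|\beta_{(1)}|-|\beta_{(2)}|}\cdots x_n^{|\beta_{(n-1)}|-|\beta_{(n)}|},$$ where the sum is over all chains $\beta_{(n)}\lessdot_\sigma\cdots\lessdot_\sigma\beta_{(1)}\lessdot_\sigma\alpha$ of weak compositions (so $\beta_{(i)}$ has length $n-i$ and $\beta_{(n)}$ is the empty composition).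
   Context: $[n]=\{1,\dots,n\}$. A weak composition is a finite sequence of nonnegative integers; $\operatorname{len}$ is its length, $|\alpha|$ the sum of its parts, $\max(\alpha)$ its largest part. **The string $\alpha^*$.** $\alpha^*$ is the word of length $n+\max(\alpha)$ in which each $i\in[n]$ occurs exactly once, all other letters are $0$, exactly $\alpha_i$ zeros precede the letter $i$, and letters $i,j\in[n]$ with $\alpha_i=\alpha_j$ occur in decreasing order from left to right. (E.g. $(0,3,0,1,3)^*=31040052$.) **Atom model.** Tiles are unit cells with edges (left, top, bottom, right) labelled by elements of $\{0\}\cup[n]$ in one of the following ways: $(0,0,0,0)$; $(0,i,0,i)$; $(i,0,i,0)$; $(j,i,j,i)$ with $i\le j$; $(g,f,f,g)$ with $\sigma(f)<\sigma(g)$; $(0,i,i,0)$; here $i,j,f,g\in[n]$. A tile $(0,i,i,0)$ in column $c$ has weight $x_c$; all other tiles have weight $1$. The atom model is a grid with $n$ columns (numbered $1,\dots,n$ left to right) and $n+\max(\alpha)$ rows. The left boundary, read bottom to top, is labelled by $\alpha^*$; the bottom boundary, read left to right, is labelled $\sigma^{-1}(1),\dots,\sigma^{-1}(n)$; the top and right boundaries are labelled $0$. A tiling places a tile in each cell so that labels agree on shared edges and on the boundary. The weight of a tiling is the product of its tile weights, and the partition function is the sum of the weights of all tilings. **$\sigma$-extendability.** For weak compositions $\alpha,\beta$ of length $m$ and $\tau\in S_m$, $\beta$ is $\tau$-extendable to $\alpha$ if $\alpha_i\ge\beta_i$ for all $i$ and for all $1\le\ell<r\le m$: (1) if $\alpha_\ell\ge\alpha_r$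 and $\beta_\ell\ge\beta_r$ then $\alpha_r\le\beta_\ell$; (2) if $\alpha_\ell<\alpha_r$ and $\beta_\ell<\beta_r$ then $\alpha_\ell<\beta_r$; (3) if $\alpha_\ell\ge\alpha_r$ and $\beta_\ell<\beta_r$ then $\alpha_r=\beta_r$ and $\tau(\ell)<\tau(r)$; (4) if $\alpha_\ell<\alpha_r$ and $\beta_\ell\ge\beta_r$ then $\alpha_\ell=\beta_\ell$ and $\tau(\ell)>\tau(r)$. **Covering relation.** Set $\sigma_0=\sigma$, and let $\sigma_{i+1}$ be obtained from $\sigma_i$ (in one-line notation) by deleting the entry $1$ and subtracting $1$ from all remaining entries; let $s_i=\sigma_i^{-1}(1)$. If $\operatorname{len}(\beta)=\ell<n$ and $\operatorname{len}(\alpha)=\ell+1$, put $k=n-\ell-1$ and say $\beta\lessdot_\sigma\alpha$ if $(\beta_1,\dots,\beta_{s_k-1},0,\beta_{s_k},\dots,\beta_\ell)$ is $\sigma_k$-extendable to $\alpha$. *)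

theory Defs
  imports "HOL-Combinatorics.Permutations" "HOL-Library.FuncSet"
begin

text \<open>Weak compositions and words are lists of natural numbers; \<open>part\<close> provides the 1-based
  indexing of the mathematical text.\<close>

definition part :: "nat list \<Rightarrow> nat \<Rightarrow> nat" where
  "part a i = a ! (i - 1)"

subsection \<open>The string of a weak composition\<close>

definition is_star :: "nat list \<Rightarrow> nat list \<Rightarrow> bool" where
  "is_star a w \<longleftrightarrow>
     (let n = length a in
       length w = n + Max (set a) \<and>
       set w \<subseteq> {0..n} \<and>
       (\<forall>i\<in>{1..n}. count_list w i = 1) \<and>
       (\<forall>p<length w. w ! p \<in> {1..n} \<longrightarrow> count_list (take p w) 0 = part a (w ! p)) \<and>
       (\<forall>q<length w. \<forall>p<q. w ! p \<in> {1..n} \<longrightarrow> w ! q \<in> {1..n} \<longrightarrow>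
          part a (w ! p) = part a (w ! q) \<longrightarrow> w ! p > w ! q))"

text \<open>Existence and uniqueness are proved in \<open>is_star_star\<close> and \<open>is_star_unique\<close> below.\<close>

definition star :: "nat list \<Rightarrow> nat list" where
  "star a = (THE w. is_star a w)"

subsection \<open>The atom model\<close>

text \<open>The edge label \<open>0\<close> stands for an edge carrying no path.\<close>

datatype tile = Tile (tleft: nat) (ttop: nat) (tbottom: nat) (tright: nat)

inductive_set tiles :: "nat \<Rightarrow> (nat \<Rightarrow> nat) \<Rightarrow> tile set" for n :: nat and \<sigma> :: "nat \<Rightarrow> nat" where
  "Tile 0 0 0 0 \<in> tiles n \<sigma>"
| "i \<in> {1..n} \<Longrightarrow> Tile 0 i 0 i \<in> tiles n \<sigma>"
| "i \<in> {1..n} \<Longrightarrow> Tile i 0 i 0 \<in> tiles n \<sigma>"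
| "i \<in> {1..n} \<Longrightarrow> j \<in> {1..n} \<Longrightarrow> i \<le> j \<Longrightarrow> Tile j i j i \<in> tiles n \<sigma>"
| "f \<in> {1..n} \<Longrightarrow> g \<in> {1..n} \<Longrightarrow> \<sigma> f < \<sigma> g \<Longrightarrow> Tile g f f g \<in> tiles n \<sigma>"
| "i \<in> {1..n} \<Longrightarrow> Tile 0 i i 0 \<in> tiles n \<sigma>"

definition tile_weight :: "nat \<Rightarrow> (nat \<Rightarrow> 'a::comm_ring_1) \<Rightarrow> nat \<Rightarrow> tile \<Rightarrow> 'a" where
  "tile_weight n x c t = (if \<exists>i\<in>{1..n}. t = Tile 0 i i 0 then x c else 1)"

definition nrows :: "nat list \<Rightarrow> nat" where
  "nrows a = length a + Max (set a)"

text \<open>A cell is a pair (row, column); rows are numbered \<open>1, 2, \<dots>\<close> from bottom to top and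
  columns from left to right. Tilings are extensional functions, so that each tiling is
  represented exactly once.\<close>

definition tilings :: "(nat \<Rightarrow> nat) \<Rightarrow> nat list \<Rightarrow> (nat \<times> nat \<Rightarrow> tile) set" where
  "tilings \<sigma> a = (let n = length a; R = nrows a in
     {T \<in> ({1..R} \<times> {1..n}) \<rightarrow>\<^sub>E tiles n \<sigma>.
        (\<forall>r\<in>{1..R}. \<forall>c\<in>{1..<n}. tright (T (r, c)) = tleft (T (r, Suc c))) \<and>
        (\<forall>r\<in>{1..<R}. \<forall>c\<in>{1..n}. ttop (T (r, c)) = tbottom (T (Suc r, c))) \<and>
        (\<forall>r\<in>{1..R}. tleft (T (r, 1)) = part (star a) r) \<and>
        (\<forall>r\<in>{1..R}. tright (T (r, n)) = 0) \<and>
        (\<forall>c\<in>{1..n}. tbottom (T (1, c)) = inv \<sigma> c) \<and>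
        (\<forall>c\<in>{1..n}. ttop (T (R, c)) = 0)})"

definition tiling_weight ::
  "nat list \<Rightarrow> (nat \<Rightarrow> 'a::comm_ring_1) \<Rightarrow> (nat \<times> nat \<Rightarrow> tile) \<Rightarrow> 'a" where
  "tiling_weight a x T =
     (\<Prod>(r, c)\<in>{1..nrows a} \<times> {1..length a}. tile_weight (length a) x c (T (r, c)))"

definition partition_function ::
  "(nat \<Rightarrow> nat) \<Rightarrow> nat list \<Rightarrow> (nat \<Rightarrow> 'a::comm_ring_1) \<Rightarrow> 'a" where
  "partition_function \<sigma> a x = (\<Sum>T\<in>tilings \<sigma> a. tiling_weight a x T)"

subsection \<open>Extendability and the covering relation\<close>

definition extendable :: "(nat \<Rightarrow> nat) \<Rightarrow> nat list \<Rightarrow> nat list \<Rightarrow> bool" where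
  "extendable \<tau> b a \<longleftrightarrow> length b = length a \<and>
     (\<forall>i\<in>{1..length a}. part a i \<ge> part b i) \<and>
     (\<forall>r\<in>{1..length a}. \<forall>l\<in>{1..<r}.
        (part a l \<ge> part a r \<and> part b l \<ge> part b r \<longrightarrow> part a r \<le> part b l) \<and>
        (part a l < part a r \<and> part b l < part b r \<longrightarrow> part a l < part b r) \<and>
        (part a l \<ge> part a r \<and> part b l < part b r \<longrightarrow> part a r = part b r \<and> \<tau> l < \<tau> r) \<and>
        (part a l < part a r \<and> part b l \<ge> part b r \<longrightarrow> part a l = part b l \<and> \<tau> l > \<tau> r))"

definition one_line :: "nat \<Rightarrow> (nat \<Rightarrow> nat) \<Rightarrow> nat list" where
  "one_line n \<sigma> = map \<sigma> [1..<Suc n]"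

text \<open>The permutation with a given one-line notation; being the identity off \<open>{1..length w}\<close>
  makes \<open>inv\<close> the inverse permutation.\<close>

definition of_one_line :: "nat list \<Rightarrow> nat \<Rightarrow> nat" where
  "of_one_line w i = (if i \<in> {1..length w} then part w i else i)"

definition delete_one :: "nat list \<Rightarrow> nat list" where
  "delete_one w = map (\<lambda>v. v - 1) (filter (\<lambda>v. v \<noteq> 1) w)"

definition sigma_seq :: "nat \<Rightarrow> (nat \<Rightarrow> nat) \<Rightarrow> nat \<Rightarrow> nat \<Rightarrow> nat" where
  "sigma_seq n \<sigma> k = of_one_line ((delete_one ^^ k) (one_line n \<sigma>))"

definition insert_zero :: "nat \<Rightarrow> nat list \<Rightarrow> nat list" where
  "insert_zero s b = take (s - 1) b @ 0 # drop (s - 1) b"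

definition covered :: "nat \<Rightarrow> (nat \<Rightarrow> nat) \<Rightarrow> nat list \<Rightarrow> nat list \<Rightarrow> bool" where
  "covered n \<sigma> b a \<longleftrightarrow> length b < n \<and> length a = Suc (length b) \<and>
     (let k = n - length b - 1; \<tau> = sigma_seq n \<sigma> k; s = inv \<tau> 1
      in extendable \<tau> (insert_zero s b) a)"

text \<open>A chain below \<open>a\<close> is the list \<open>bs\<close> of its \<open>n\<close> members in descending order, so that
  \<open>(a # bs) ! i\<close> is the \<open>i\<close>-th member, the \<open>0\<close>-th one being \<open>a\<close> itself.\<close>

definition covering_chains :: "nat \<Rightarrow> (nat \<Rightarrow> nat) \<Rightarrow> nat list \<Rightarrow> nat list list set" where
  "covering_chains n \<sigma> a =
     {bs. length bs = n \<and> (\<forall>i\<in>{1..n}. covered n \<sigma> ((a # bs) ! i) ((a # bs) ! (i - 1)))}"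

subsection \<open>Well-definedness\<close>

text \<open>The letters preceding \<open>i\<close> in the string, and the (0-based) position of \<open>i\<close>.\<close>

definition star_before :: "nat list \<Rightarrow> nat \<Rightarrow> nat set" where
  "star_before a i =
     {j \<in> {1..length a}. part a j < part a i \<or> part a j = part a i \<and> j > i}"

definition star_pos :: "nat list \<Rightarrow> nat \<Rightarrow> nat" where
  "star_pos a i = part a i + card (star_before a i)"

lemma count_list_take_card:
  assumes "p \<le> length w"
  shows "count_list (take p w) v = card {q. q < p \<and> w ! q = v}"
proof -
  have "count_list (take p w) v = card {q. q < length (take p w) \<and> take p w ! q = v}"
    by (simp add: count_list_eq_length_filter length_filter_conv_card eq_commute)
  also have "{q. q < length (take p w) \<and> take p w ! q = v} = {q. q < p \<and> w ! q = v}"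
    using assms by auto
  finally show ?thesis .
qed

lemma count_list_card: "count_list w v = card {q. q < length w \<and> w ! q = v}"
  using count_list_take_card[of "length w" w v] by simp

lemma card_lessThan_split:
  fixes p :: nat
  shows "p = card {q. q < p \<and> P q} + card {q. q < p \<and> \<not> P q}"
proof -
  have "{..<p} = {q. q < p \<and> P q} \<union> {q. q < p \<and> \<not> P q}" by auto
  hence "card {..<p} = card {q. q < p \<and> P q} + card {q. q < p \<and> \<not> P q}"
    by (metis (no_types, lifting) card_Un_disjoint disjoint_iff finite_Un finite_lessThan mem_Collect_eq)
  thus ?thesis by simp
qed

lemma is_star_position:
  assumes w: "is_star a w" and p: "p < length w" and i: "w ! p \<in> {1..length a}"
  shows "p = star_pos a (w ! p)"
proof -
  let ?n = "length a"
  have set: "set w \<subseteq> {0..?n}"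
    using w unfolding is_star_def Let_def by blast
  have one: "card {q. q < length w \<and> w ! q = i} = 1" if "i \<in> {1..?n}" for i
  proof -
    have "count_list w i = 1" using w that unfolding is_star_def Let_def by blast
    thus ?thesis by (simp only: count_list_card)
  qed
  have zeros: "card {q. q < p \<and> w ! q = 0} = part a (w ! p)"
    if "p < length w" "w ! p \<in> {1..?n}" for p
  proof -
    have "count_list (take p w) 0 = part a (w ! p)"
      using w that unfolding is_star_def Let_def by blast
    thus ?thesis using that by (simp add: count_list_take_card)
  qed
  have ord: "w ! p > w ! q"
    if "q < length w" "p < q" "w ! p \<in> {1..?n}" "w ! q \<in> {1..?n}"
      "part a (w ! p) = part a (w ! q)" for p q
    using w that unfolding is_star_def Let_def by blast
  have before: "w ! q \<in> star_before a (w ! p)"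
    if "p < length w" "q < p" "w ! p \<in> {1..?n}" "w ! q \<in> {1..?n}" for p q
  proof -
    have "card {r. r < q \<and> w ! r = 0} \<le> card {r. r < p \<and> w ! r = 0}"
      using that by (intro card_mono) auto
    hence "part a (w ! q) \<le> part a (w ! p)"
      using zeros[of p] zeros[of q] that by auto
    thus ?thesis using ord[of p q] that by (auto simp: star_before_def)
  qed
  have inj: "inj_on ((!) w) {q. q < p \<and> w ! q \<noteq> 0}"
  proof (rule inj_onI)
    fix q r assume q: "q \<in> {q. q < p \<and> w ! q \<noteq> 0}" and r: "r \<in> {q. q < p \<and> w ! q \<noteq> 0}"
      and eq: "w ! q = w ! r"
    have "w ! q \<in> set w" using q p by simp
    hence "w ! q \<in> {1..?n}" using set q by force
    from one[OF this] obtain t where "{u. u < length w \<and> w ! u = w ! q} = {t}"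
      by (auto simp: card_1_singleton_iff)
    moreover have "q \<in> {u. u < length w \<and> w ! u = w ! q}" using q p by auto
    moreover have "r \<in> {u. u < length w \<and> w ! u = w ! q}" using r p eq by auto
    ultimately show "q = r" by (metis singletonD)
  qed
  have img: "(!) w ` {q. q < p \<and> w ! q \<noteq> 0} = star_before a (w ! p)"
  proof
    show "(!) w ` {q. q < p \<and> w ! q \<noteq> 0} \<subseteq> star_before a (w ! p)"
    proof
      fix j assume "j \<in> (!) w ` {q. q < p \<and> w ! q \<noteq> 0}"
      then obtain q where q: "q < p" "w ! q \<noteq> 0" "j = w ! q" by auto
      have "w ! q \<in> set w" using q p by simp
      hence "w ! q \<in> {1..?n}" using set q by force
      thus "j \<in> star_before a (w ! p)" using before[OF p q(1) i] q by simp
    qed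
  next
    show "star_before a (w ! p) \<subseteq> (!) w ` {q. q < p \<and> w ! q \<noteq> 0}"
    proof
      fix j assume j: "j \<in> star_before a (w ! p)"
      hence jn: "j \<in> {1..?n}" by (simp add: star_before_def)
      from one[OF jn] obtain q where q: "q < length w" "w ! q = j"
        by (auto simp: card_1_singleton_iff)
      have "q \<noteq> p" using j q by (auto simp: star_before_def)
      moreover have "\<not> p < q"
      proof
        assume "p < q"
        with before[of q p] q i jn have "w ! p \<in> star_before a j" by simp
        with j show False by (auto simp: star_before_def)
      qed
      ultimately have "q < p" by simp
      thus "j \<in> (!) w ` {q. q < p \<and> w ! q \<noteq> 0}" using q jn by (auto simp: image_iff)
    qed
  qed
  have "card {q. q < p \<and> w ! q \<noteq> 0} = card (star_before a (w ! p))"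
    using card_image[OF inj] img by simp
  thus ?thesis
    using card_lessThan_split[of p "\<lambda>q. w ! q = 0"] zeros[OF p i] by (simp add: star_pos_def)
qed

lemma star_pos_less:
  assumes "j \<in> star_before a i" "i \<in> {1..length a}"
  shows "star_pos a j < star_pos a i"
proof -
  have "star_before a j \<subset> star_before a i"
    using assms by (auto simp: star_before_def)
  moreover have "finite (star_before a i)" by (simp add: star_before_def)
  ultimately have "card (star_before a j) < card (star_before a i)"
    by (simp add: psubset_card_mono)
  moreover have "part a j \<le> part a i" using assms by (auto simp: star_before_def)
  ultimately show ?thesis by (simp add: star_pos_def)
qed

lemma star_pos_less_iff:
  assumes "i \<in> {1..length a}" "j \<in> {1..length a}"
  shows "star_pos a j < star_pos a i \<longleftrightarrow> j \<in> star_before a i"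
proof -
  consider "j \<in> star_before a i" | "i \<in> star_before a j" | "i = j"
    using assms unfolding star_before_def mem_Collect_eq by (metis linorder_neqE_nat)
  thus ?thesis
  proof cases
    case 1
    thus ?thesis using star_pos_less[OF 1 assms(1)] by simp
  next
    case 2
    thus ?thesis using star_pos_less[OF 2 assms(2)] by (auto simp: star_before_def)
  next
    case 3
    thus ?thesis by (simp add: star_before_def)
  qed
qed

lemma star_pos_inject:
  assumes "i \<in> {1..length a}" "j \<in> {1..length a}" "star_pos a i = star_pos a j"
  shows "i = j"
proof -
  have "i \<notin> star_before a j" "j \<notin> star_before a i"
    using assms star_pos_less_iff[of i a j] star_pos_less_iff[of j a i] by auto
  thus ?thesis using assms by (auto simp: star_before_def)
qed

lemma ex_is_star: "\<exists>w. is_star a w"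
proof -
  let ?n = "length a" and ?N = "length a + Max (set a)"
  define f where "f p = (if \<exists>i\<in>{1..?n}. star_pos a i = p
    then THE i. i \<in> {1..?n} \<and> star_pos a i = p else 0)" for p
  define w where "w = map f [0..<?N]"
  have len: "length w = ?N" by (simp add: w_def)
  have f_pos: "f (star_pos a i) = i" if "i \<in> {1..?n}" for i
  proof -
    have "(THE j. j \<in> {1..?n} \<and> star_pos a j = star_pos a i) = i"
      using that star_pos_inject by (intro the_equality) auto
    thus ?thesis using that by (auto simp: f_def)
  qed
  have f_cases: "f p = 0 \<or> f p \<in> {1..?n} \<and> star_pos a (f p) = p" for p
  proof (cases "\<exists>i\<in>{1..?n}. star_pos a i = p")
    case True
    then obtain i where "i \<in> {1..?n}" "star_pos a i = p" by auto
    thus ?thesis using f_pos[of i] by auto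
  next
    case False
    thus ?thesis unfolding f_def by (subst if_not_P) auto
  qed
  have pos_lt: "star_pos a i < ?N" if i: "i \<in> {1..?n}" for i
  proof -
    have "star_before a i \<subseteq> {1..?n}" "i \<notin> star_before a i"
      by (auto simp: star_before_def)
    hence "star_before a i \<subset> {1..?n}" using i by blast
    hence "card (star_before a i) < card {1..?n}" by (intro psubset_card_mono) auto
    moreover have "part a i \<le> Max (set a)" using i by (intro Max_ge) (auto simp: part_def)
    ultimately show ?thesis by (simp add: star_pos_def)
  qed
  have nth: "w ! p = f p" if "p < ?N" for p using that by (simp add: w_def)
  have "set w \<subseteq> {0..?n}"
  proof
    fix v assume "v \<in> set w"
    then obtain p where "v = f p" by (auto simp: w_def)
    thus "v \<in> {0..?n}" using f_cases[of p] by auto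
  qed
  moreover have "count_list w i = 1" if i: "i \<in> {1..?n}" for i
  proof -
    have "{p. p < length w \<and> w ! p = i} = {star_pos a i}"
    proof (intro equalityI subsetI)
      fix p assume "p \<in> {p. p < length w \<and> w ! p = i}"
      thus "p \<in> {star_pos a i}" using f_cases[of p] i by (auto simp: len nth)
    next
      fix p assume "p \<in> {star_pos a i}"
      thus "p \<in> {p. p < length w \<and> w ! p = i}" using f_pos[OF i] pos_lt[OF i]
        by (auto simp: len nth)
    qed
    thus ?thesis by (simp add: count_list_card)
  qed
  moreover have "count_list (take p w) 0 = part a (w ! p)"
    if p: "p < length w" and i: "w ! p \<in> {1..?n}" for p
  proof -
    let ?i = "w ! p"
    have pos: "p = star_pos a ?i" using f_cases[of p] p i by (simp add: len nth)
    have "{q. q < p \<and> w ! q \<noteq> 0} = star_pos a ` star_before a ?i"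
    proof (intro equalityI subsetI)
      fix q assume q: "q \<in> {q. q < p \<and> w ! q \<noteq> 0}"
      hence fq: "f q \<in> {1..?n}" "star_pos a (f q) = q"
        using f_cases[of q] p by (auto simp: len nth)
      hence "f q \<in> star_before a ?i"
        using star_pos_less_iff[OF i fq(1)] pos q by auto
      thus "q \<in> star_pos a ` star_before a ?i" using fq by force
    next
      fix q assume "q \<in> star_pos a ` star_before a ?i"
      then obtain j where j: "j \<in> star_before a ?i" "q = star_pos a j" by auto
      hence jn: "j \<in> {1..?n}" by (simp add: star_before_def)
      have "q < p" using star_pos_less[OF j(1) i] j(2) pos by simp
      thus "q \<in> {q. q < p \<and> w ! q \<noteq> 0}" using f_pos[OF jn] jn j p by (simp add: len nth)
    qed
    moreover have "inj_on (star_pos a) (star_before a ?i)"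
      using star_pos_inject by (intro inj_onI) (auto simp: star_before_def)
    ultimately have "card {q. q < p \<and> w ! q \<noteq> 0} = card (star_before a ?i)"
      by (simp add: card_image)
    hence "card {q. q < p \<and> w ! q = 0} = part a ?i"
      using card_lessThan_split[of p "\<lambda>q. w ! q = 0"] pos by (simp add: star_pos_def)
    thus ?thesis using p by (simp add: count_list_take_card)
  qed
  moreover have "w ! p > w ! q"
    if "q < length w" "p < q" "w ! p \<in> {1..?n}" "w ! q \<in> {1..?n}"
      "part a (w ! p) = part a (w ! q)" for p q
  proof -
    have "star_pos a (w ! p) = p" "star_pos a (w ! q) = q"
      using f_cases[of p] f_cases[of q] that by (auto simp: len nth)
    hence "w ! p \<in> star_before a (w ! q)"
      using star_pos_less_iff[OF that(4) that(3)] that by simp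
    thus ?thesis using that by (simp add: star_before_def)
  qed
  ultimately have "is_star a w"
    unfolding is_star_def Let_def using len by blast
  thus ?thesis ..
qed

lemma is_star_unique:
  assumes w: "is_star a w" and v: "is_star a v"
  shows "w = v"
proof -
  have sub: "v ! p = w ! p"
    if w: "is_star a w" and v: "is_star a v" and p: "p < length w" "w ! p \<noteq> 0" for w v p
  proof -
    have "w ! p \<in> set w" using p by simp
    hence i: "w ! p \<in> {1..length a}" using w p by (force simp: is_star_def Let_def)
    have "count_list v (w ! p) = 1"
      using v i unfolding is_star_def Let_def by blast
    hence "card {q. q < length v \<and> v ! q = w ! p} = 1"
      by (simp only: count_list_card)
    then obtain q where q: "q < length v" "v ! q = w ! p"
      by (auto simp: card_1_singleton_iff)
    have "q = p" using is_star_position[OF w p(1) i] is_star_position[OF v q(1)] q i by simp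
    thus ?thesis using q by simp
  qed
  have len: "length w = length v" using w v by (simp add: is_star_def Let_def)
  show ?thesis
  proof (rule nth_equalityI[OF len])
    fix p assume p: "p < length w"
    show "w ! p = v ! p"
    proof (cases "w ! p = 0 \<and> v ! p = 0")
      case False
      hence "w ! p \<noteq> 0 \<or> v ! p \<noteq> 0" by simp
      moreover have "p < length v" using p len by simp
      ultimately show ?thesis using sub[OF w v p] sub[OF v w] by metis
    qed simp
  qed
qed

lemma is_star_star: "is_star a (star a)"
proof -
  obtain w where "is_star a w" using ex_is_star by blast
  moreover from this have "v = w" if "is_star a v" for v
    using that by (rule is_star_unique[rotated])
  ultimately show ?thesis unfolding star_def by (rule theI)
qed

lemma finite_tiles: "finite (tiles n \<sigma>)"
proof (rule finite_subset)
  show "tiles n \<sigma> \<subseteq> (\<lambda>(a, b, c, d). Tile a b c d) ` ({0..n} \<times> {0..n} \<times> {0..n} \<times> {0..n})"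
    by (auto elim!: tiles.cases simp: image_iff)
qed auto

lemma finite_tilings: "finite (tilings \<sigma> a)"
  by (rule finite_subset[of _ "({1..nrows a} \<times> {1..length a}) \<rightarrow>\<^sub>E tiles (length a) \<sigma>"])
     (auto simp: tilings_def Let_def intro!: finite_PiE finite_tiles)

lemma covered_sum_list:
  assumes "covered n \<sigma> b a"
  shows "sum_list b \<le> sum_list a"
proof -
  define s where "s = inv (sigma_seq n \<sigma> (n - length b - 1)) 1"
  have ext: "extendable (sigma_seq n \<sigma> (n - length b - 1)) (insert_zero s b) a"
    using assms by (simp add: covered_def Let_def s_def)
  have "sum_list b = sum_list (take (s - 1) b @ drop (s - 1) b)"
    by simp
  also have "\<dots> = sum_list (insert_zero s b)"
    unfolding insert_zero_def sum_list_append by simp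
  also have "\<dots> = (\<Sum>i<length a. insert_zero s b ! i)"
    using ext by (simp add: sum_list_sum_nth extendable_def atLeast0LessThan)
  also have "\<dots> \<le> (\<Sum>i<length a. a ! i)"
  proof (rule sum_mono)
    fix i assume "i \<in> {..<length a}"
    hence "Suc i \<in> {1..length a}" by auto
    hence "part a (Suc i) \<ge> part (insert_zero s b) (Suc i)"
      using ext unfolding extendable_def by blast
    thus "insert_zero s b ! i \<le> a ! i" by (simp add: part_def)
  qed
  also have "\<dots> = sum_list a"
    by (simp add: sum_list_sum_nth atLeast0LessThan)
  finally show ?thesis .
qed

lemma finite_covering_chains: "finite (covering_chains n \<sigma> a)"
proof -
  define S where "S = {b :: nat list. set b \<subseteq> {0..sum_list a} \<and> length b \<le> n}"
  have "finite S" unfolding S_def by (rule finite_lists_length_le) simp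
  have "covering_chains n \<sigma> a \<subseteq> {bs. set bs \<subseteq> S \<and> length bs = n}"
  proof
    fix bs assume bs: "bs \<in> covering_chains n \<sigma> a"
    have len: "length bs = n" using bs by (simp add: covering_chains_def)
    have cov: "covered n \<sigma> (bs ! i) ((a # bs) ! i)" if "i < n" for i
    proof -
      have "Suc i \<in> {1..n}" using that by simp
      hence "covered n \<sigma> ((a # bs) ! Suc i) ((a # bs) ! (Suc i - 1))"
        using bs unfolding covering_chains_def by blast
      thus ?thesis by simp
    qed
    have le: "sum_list ((a # bs) ! i) \<le> sum_list a" if "i \<le> n" for i
      using that
    proof (induction i)
      case (Suc i)
      hence "sum_list (bs ! i) \<le> sum_list ((a # bs) ! i)"
        using covered_sum_list[OF cov[of i]] by simp
      with Suc show ?case by simp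
    qed simp
    have "bs ! i \<in> S" if "i < n" for i
    proof -
      have "set (bs ! i) \<subseteq> {0..sum_list a}"
      proof
        fix v assume "v \<in> set (bs ! i)"
        hence "v \<le> sum_list (bs ! i)" by (simp add: member_le_sum_list)
        also have "\<dots> \<le> sum_list a" using le[of "Suc i"] that by simp
        finally show "v \<in> {0..sum_list a}" by simp
      qed
      moreover have "length (bs ! i) \<le> n"
        using cov[OF that] by (simp add: covered_def)
      ultimately show ?thesis by (simp add: S_def)
    qed
    with len show "bs \<in> {bs. set bs \<subseteq> S \<and> length bs = n}"
      by (auto simp: set_conv_nth)
  qed
  moreover have "finite {bs. set bs \<subseteq> S \<and> length bs = n}"
    using \<open>finite S\<close> by (rule finite_lists_length_eq)
  ultimately show ?thesis by (rule finite_subset)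
qed

end

theory Submission
  imports Defs
begin

text \<open>
  A tiling is determined by its horizontal edge labels, that is, by the words read on the vertical
  lines between consecutive columns: labels are conserved in every tile, so the vertical labels of
  a column follow from its two boundary words. The left word of the first column is the string of
  the composition \<open>\<alpha>\<close>, and in each column the label entering at the bottom disappears
  while some of the remaining labels move down.

  Order the labels of a composition \<open>a\<close> by the keys \<open>(a\<^sub>i, -i)\<close>. The four conditions of
  extendability then say: if \<open>i\<close> comes before \<open>j\<close> in \<open>a\<close>, then either \<open>j\<close> also comes
  after \<open>i\<close> in \<open>b\<close> and its new key still exceeds the old key of \<open>i\<close>, or \<open>j\<close> jumps over
  \<open>i\<close>, and then \<open>i\<close> stays put and \<open>\<sigma> j < \<sigma> i\<close>. This is exactly what a single vertical
  path that changes its label on its way up can do, so a column whose left word is the string of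
  \<open>a\<close> and whose right word is again a string corresponds to one covering step.

  That every right word is a string needs the whole tiling: a column may place \<open>i\<close> immediately
  before a larger \<open>i'\<close> with the same number of preceding zeros, but only if \<open>\<sigma> i < \<sigma> i'\<close>, and
  such a pair can never be removed by later columns, while the last right word is zero.
\<close>

subsection \<open>Words\<close>

text \<open>Two patterns cover the six shapes: left = bottom with top = right, or left = right with
  top = bottom. In both, left and top together carry the same two labels as bottom and right. Left =
  bottom never holds in the second pattern, so these two edges decide which one occurs.\<close>

lemma Tile_in_tiles_iff:
  "Tile l t b r \<in> tiles n \<sigma> \<longleftrightarrow>
     l = b \<and> t = r \<and> l \<le> n \<and> r \<le> n \<and> (l = 0 \<or> r \<le> l) \<or>
     l = r \<and> t = b \<and> b \<in> {1..n} \<and> (l = 0 \<or> l \<le> n \<and> \<sigma> b < \<sigma> l)"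
proof (intro iffI)
  assume "Tile l t b r \<in> tiles n \<sigma>"
  then show "l = b \<and> t = r \<and> l \<le> n \<and> r \<le> n \<and> (l = 0 \<or> r \<le> l) \<or>
     l = r \<and> t = b \<and> b \<in> {1..n} \<and> (l = 0 \<or> l \<le> n \<and> \<sigma> b < \<sigma> l)"
    by cases auto
next
  assume *: "l = b \<and> t = r \<and> l \<le> n \<and> r \<le> n \<and> (l = 0 \<or> r \<le> l) \<or>
     l = r \<and> t = b \<and> b \<in> {1..n} \<and> (l = 0 \<or> l \<le> n \<and> \<sigma> b < \<sigma> l)"
  then show "Tile l t b r \<in> tiles n \<sigma>"
    by (cases "l = 0"; cases "r = 0") (auto intro: tiles.intros)
qed

section \<open>Counting letters below a given height\<close>

definition occ :: "(nat \<Rightarrow> nat) \<Rightarrow> nat \<Rightarrow> nat \<Rightarrow> nat" where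
  "occ W k p = (\<Sum>q<p. of_bool (W q = k))"

lemma occ_0 [simp]: "occ W k 0 = 0"
  by (simp add: occ_def)

lemma occ_Suc [simp]: "occ W k (Suc p) = occ W k p + of_bool (W p = k)"
  by (simp add: occ_def)

lemma occ_mono: "p \<le> q \<Longrightarrow> occ W k p \<le> occ W k q"
  unfolding occ_def by (rule sum_mono2) auto

lemma occ_less: "p < q \<Longrightarrow> W p = k \<Longrightarrow> occ W k p < occ W k q"
  using occ_mono[of "Suc p" q W k] by simp

lemma occ_pos_iff: "0 < occ W k p \<longleftrightarrow> (\<exists>q<p. W q = k)"
  by (induction p) (auto simp: less_Suc_eq)

lemma occ_eq_imp_neq: "occ W k p = occ W k q \<Longrightarrow> p \<le> r \<Longrightarrow> r < q \<Longrightarrow> W r \<noteq> k"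
  using occ_less[of r q W k] occ_mono[of p r W k] by auto

lemma occ_cong: "(\<And>q. q < p \<Longrightarrow> W q = W' q) \<Longrightarrow> occ W k p = occ W' k p"
  by (simp add: occ_def)

lemma occ_single:
  assumes "W r = k" "\<And>q. W q = k \<Longrightarrow> q = r"
  shows "occ W k p = of_bool (r < p)"
proof (induction p)
  case (Suc p)
  have "W p = k \<longleftrightarrow> p = r" using assms by blast
  with Suc show ?case by (auto simp: less_Suc_eq)
qed simp

text \<open>Compares the keys \<open>(a\<^sub>i, -i)\<close> and \<open>(b\<^sub>j, -j)\<close> lexicographically.\<close>

definition precedes :: "(nat \<Rightarrow> nat) \<Rightarrow> (nat \<Rightarrow> nat) \<Rightarrow> nat \<Rightarrow> nat \<Rightarrow> bool" where
  "precedes a b i j \<longleftrightarrow> a i < b j \<or> a i = b j \<and> j < i"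

lemma precedes_asym: "precedes a a i j \<Longrightarrow> \<not> precedes a a j i"
  by (auto simp: precedes_def)

lemma precedes_total: "i \<noteq> j \<Longrightarrow> precedes a a i j \<or> precedes a a j i"
  by (auto simp: precedes_def)

section \<open>Words with prescribed numbers of zeros before their labels\<close>

definition ascent_free :: "(nat \<Rightarrow> nat) \<Rightarrow> bool" where
  "ascent_free W \<longleftrightarrow> (\<forall>p. W p \<noteq> 0 \<longrightarrow> W (Suc p) \<le> W p)"

text \<open>For finite \<open>L\<close> this is the string of \<open>f\<close> on the labels
  \<open>L\<close>, continued upwards by zeros; indexing by all naturals gives the words of all
  columns one shape, however many labels are left. Labels with equally many zeros before them form a
  zero-free run, so the tie rule becomes a condition on neighbours,
  \<open>ascent_free\<close>.\<close>

definition word :: "nat set \<Rightarrow> (nat \<Rightarrow> nat) \<Rightarrow> (nat \<Rightarrow> nat) \<Rightarrow> bool" where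
  "word L f W \<longleftrightarrow> 0 \<notin> L \<and> range W \<subseteq> insert 0 L \<and> (\<forall>i\<in>L. \<exists>!p. W p = i) \<and>
     (\<forall>p. W p \<noteq> 0 \<longrightarrow> occ W 0 p = f (W p)) \<and> ascent_free W"

lemma
  assumes "word L f W"
  shows word_0_notin: "0 \<notin> L"
    and word_mem: "W p \<noteq> 0 \<Longrightarrow> W p \<in> L"
    and word_ex1: "i \<in> L \<Longrightarrow> \<exists>!p. W p = i"
    and word_occ: "W p \<noteq> 0 \<Longrightarrow> occ W 0 p = f (W p)"
    and word_ascent_free: "ascent_free W"
proof -
  have w: "0 \<notin> L" "range W \<subseteq> insert 0 L" "\<forall>i\<in>L. \<exists>!p. W p = i"
    "\<forall>p. W p \<noteq> 0 \<longrightarrow> occ W 0 p = f (W p)" "ascent_free W"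
    using assms unfolding word_def by iprover+
  show "0 \<notin> L" "ascent_free W" using w(1,5) .
  show "W p \<noteq> 0 \<Longrightarrow> W p \<in> L" using subsetD[OF w(2) rangeI, of p] by simp
  show "i \<in> L \<Longrightarrow> \<exists>!p. W p = i" using w(3) by (rule bspec)
  show "W p \<noteq> 0 \<Longrightarrow> occ W 0 p = f (W p)" using w(4) by iprover
qed

definition row :: "(nat \<Rightarrow> nat) \<Rightarrow> nat \<Rightarrow> nat" where
  "row W i = (THE p. W p = i)"

lemma word_row:
  assumes "word L f W" "i \<in> L"
  shows "W (row W i) = i"
  unfolding row_def by (rule theI'[OF word_ex1[OF assms]])

lemma row_eq:
  assumes "word L f W" "W p = i" "i \<noteq> 0"
  shows "row W i = p"
  unfolding row_def
  using word_ex1[OF assms(1), of i] word_mem[OF assms(1), of p] assms(2,3)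
  by (intro the1_equality) auto

lemma word_nonzero: "word L f W \<Longrightarrow> i \<in> L \<Longrightarrow> i \<noteq> 0"
  using word_0_notin by metis

lemma occ_row:
  assumes "word L f W" "i \<in> L"
  shows "occ W i p = of_bool (row W i < p)"
  using word_row[OF assms] row_eq[OF assms(1)] word_nonzero[OF assms]
  by (intro occ_single) auto

lemma ascent_free_less:
  assumes "ascent_free W" "p \<le> q" "\<And>r. p \<le> r \<Longrightarrow> r \<le> q \<Longrightarrow> W r \<noteq> 0"
  shows "W q \<le> W p"
  using assms(2,3)
proof (induction q rule: dec_induct)
  case (step q)
  have "W (Suc q) \<le> W q"
    using assms(1) step by (simp add: ascent_free_def)
  also have "W q \<le> W p" using step by auto
  finally show ?case .
qed simp

text \<open>With different zero counts the lower label has the smaller one. With equal counts no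
  zero lies between the two rows, so the labels decrease along them.\<close>

lemma word_precedes:
  assumes w: "word L f W" and "p < q" "W p \<noteq> 0" "W q \<noteq> 0"
  shows "precedes f f (W p) (W q)"
proof -
  have f: "f (W p) = occ W 0 p" "f (W q) = occ W 0 q"
    using word_occ[OF w] assms(3,4) by simp_all
  have neq: "W p \<noteq> W q" using row_eq[OF w _ assms(3), of p] row_eq[OF w _ assms(3), of q] assms(2) by fastforce
  show ?thesis
  proof (cases "f (W p) = f (W q)")
    case True
    then have "occ W 0 p = occ W 0 q" using f by simp
    then have "W r \<noteq> 0" if "p \<le> r" "r \<le> q" for r
      using occ_eq_imp_neq[OF _ that(1), of W 0 q] that(2) assms(4) by (cases "r = q") simp_all
    then have "W q \<le> W p"
      using \<open>p < q\<close> by (intro ascent_free_less[OF word_ascent_free[OF w]]) simp_all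
    with True neq show ?thesis by (simp add: precedes_def)
  next
    case False
    then show ?thesis using f occ_mono[of p q W 0] assms by (simp add: precedes_def)
  qed
qed

lemma word_precedes_iff:
  assumes w: "word L f W" and "W p \<noteq> 0" "W q \<noteq> 0"
  shows "precedes f f (W p) (W q) \<longleftrightarrow> p < q"
  using word_precedes[OF w, of p q] word_precedes[OF w, of q p] assms
  by (cases p q rule: linorder_cases) (auto simp: precedes_def)

lemma word_unique:
  assumes w: "word L f W" and w': "word L f W'"
  shows "W = W'"
proof -
  \<comment> \<open>At a first disagreement \<open>p\<close>, the label \<open>W p\<close> occurs in
    \<open>W'\<close> only above \<open>p\<close>. It has equally many zeros before it in both
    words, so \<open>W' p\<close> is a label too. The two labels then appear in opposite orders in
    \<open>W\<close> and \<open>W'\<close>, but the order is fixed by their keys.\<close>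
  have aux: False
    if w: "word L f W" and w': "word L f W'" and eq: "\<And>q. q < p \<Longrightarrow> W q = W' q"
      and p: "W p \<noteq> 0" "W p \<noteq> W' p" for W W' p
  proof -
    note R = word_row[OF w] row_eq[OF w refl]
    note R' = word_row[OF w'] row_eq[OF w' refl]
    let ?i = "W p"
    have i: "?i \<in> L" using word_mem[OF w] p by simp
    let ?q = "row W' ?i"
    have q: "W' ?q = ?i" using R'(1)[OF i] .
    have pq: "p < ?q"
    proof (rule ccontr)
      assume "\<not> p < ?q"
      then consider "?q < p" | "?q = p" by linarith
      then show False
        using eq[of ?q] q p R(2)[of ?q] R(2)[of p] by cases auto
    qed
    have f: "occ W' 0 ?q = occ W' 0 p"
    proof -
      have "occ W' 0 ?q = f ?i" using word_occ[OF w', of ?q] q p by simp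
      moreover have "f ?i = occ W 0 p" using word_occ[OF w] p by simp
      ultimately show ?thesis using eq occ_cong[of p W W'] by simp
    qed
    have e0: "W' p \<noteq> 0" using occ_less[OF pq, of W' 0] f by auto
    let ?e = "W' p"
    have e: "?e \<in> L" using word_mem[OF w' e0] .
    have We: "W (row W ?e) = ?e" using R(1)[OF e] .
    have "p < row W ?e"
    proof (rule ccontr)
      assume "\<not> p < row W ?e"
      then consider "row W ?e < p" | "row W ?e = p" by linarith
      then show False
      proof cases
        case 1
        with eq We have "W' (row W ?e) = W' p" by auto
        with R'(2)[of p] R'(2)[of "row W ?e"] 1 e0 show False by auto
      qed (use We p in auto)
    qed
    with word_precedes[OF w, of p "row W ?e"] p We e0 have "precedes f f ?i ?e" by simp
    moreover have "precedes f f ?e ?i"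
      using word_precedes[OF w' pq] e0 q p by simp
    ultimately show False using precedes_asym by blast
  qed
  show ?thesis
  proof (rule ext)
    fix p show "W p = W' p"
    proof (induction p rule: less_induct)
      case (less p)
      show ?case
      proof (rule ccontr)
        assume "W p \<noteq> W' p"
        moreover from this have "W p \<noteq> 0 \<or> W' p \<noteq> 0" by auto
        ultimately show False using aux[OF w w', of p] aux[OF w' w, of p] less by fastforce
      qed
    qed
  qed
qed

text \<open>A strictly increasing renaming that fixes 0 preserves zeros and comparisons of
  neighbours. This carries the string, available on \<open>{1..m}\<close>, to any finite set of
  positive labels.\<close>

lemma word_relabel:
  assumes w: "word {1..m} g V" and e: "strict_mono_on {0..m} e" "e 0 = 0"
    and f: "\<And>i. i \<in> {1..m} \<Longrightarrow> f (e i) = g i"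
  shows "word (e ` {1..m}) f (e \<circ> V)"
proof -
  have V: "V p \<in> {0..m}" for p using word_mem[OF w, of p] by (cases "V p = 0") auto
  have inj: "inj_on e {0..m}" using e by (simp add: strict_mono_on_imp_inj_on)
  have eq0: "e (V p) = 0 \<longleftrightarrow> V p = 0" for p
    using inj_onD[OF inj, of "V p" 0] V[of p] e by auto
  have occ: "occ (e \<circ> V) 0 = occ V 0" by (simp add: occ_def eq0 fun_eq_iff)
  have "0 \<notin> e ` {1..m}" using inj_onD[OF inj, of _ 0] e by force
  moreover have "range (e \<circ> V) \<subseteq> insert 0 (e ` {1..m})"
  proof
    fix y assume "y \<in> range (e \<circ> V)"
    then obtain p where "y = e (V p)" by auto
    then show "y \<in> insert 0 (e ` {1..m})" using V[of p] e by (cases "V p = 0") auto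
  qed
  moreover have "\<exists>!p. (e \<circ> V) p = i" if "i \<in> e ` {1..m}" for i
  proof -
    from that obtain k where k: "k \<in> {1..m}" "i = e k" by auto
    have "(e \<circ> V) p = i \<longleftrightarrow> V p = k" for p
      using inj_onD[OF inj, of "V p" k] V[of p] k by auto
    moreover have "\<exists>!p. V p = k" using word_ex1[OF w k(1)] .
    ultimately show ?thesis by simp
  qed
  moreover have "occ (e \<circ> V) 0 p = f ((e \<circ> V) p)" if "(e \<circ> V) p \<noteq> 0" for p
  proof -
    have "V p \<noteq> 0" using that eq0 by simp
    then show ?thesis using word_occ[OF w, of p] word_mem[OF w, of p] f[of "V p"] unfolding occ by simp
  qed
  moreover have "ascent_free (e \<circ> V)"
    unfolding ascent_free_def
  proof (intro allI impI)
    fix p assume "(e \<circ> V) p \<noteq> 0"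
    then have "V (Suc p) \<le> V p"
      using word_ascent_free[OF w] eq0 by (simp add: ascent_free_def)
    then show "(e \<circ> V) (Suc p) \<le> (e \<circ> V) p"
      using mono_onD[OF strict_mono_on_imp_mono_on[OF e(1)] V V] by simp
  qed
  ultimately show ?thesis unfolding word_def by blast
qed

lemma word_star:
  "word {1..length a} (part a) (\<lambda>p. if p < length (star a) then star a ! p else 0)"
proof -
  let ?n = "length a" and ?w = "star a"
  define W where "W p = (if p < length ?w then ?w ! p else 0)" for p
  have sub: "set ?w \<subseteq> {0..?n}"
    and one: "\<And>i. i \<in> {1..?n} \<Longrightarrow> count_list ?w i = 1"
    and before: "\<And>p. p < length ?w \<Longrightarrow> ?w ! p \<in> {1..?n} \<Longrightarrow>
      count_list (take p ?w) 0 = part a (?w ! p)"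
    and decr: "\<And>p q. q < length ?w \<Longrightarrow> p < q \<Longrightarrow> ?w ! p \<in> {1..?n} \<Longrightarrow> ?w ! q \<in> {1..?n} \<Longrightarrow>
      part a (?w ! p) = part a (?w ! q) \<Longrightarrow> ?w ! q < ?w ! p"
    using is_star_star[of a] unfolding is_star_def Let_def by blast+
  have letter: "p < length ?w" "?w ! p \<in> {1..?n}" "W p = ?w ! p" if "W p \<noteq> 0" for p
  proof -
    show p: "p < length ?w" using that by (simp add: W_def split: if_splits)
    then show "W p = ?w ! p" by (simp add: W_def)
    have "?w ! p \<in> {0..?n}" using sub nth_mem[OF p] by (rule subsetD)
    with that \<open>W p = ?w ! p\<close> show "?w ! p \<in> {1..?n}" by simp
  qed
  have occ: "occ W 0 p = count_list (take p ?w) 0" if "p < length ?w" for p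
  proof -
    have "occ W 0 p = card ({..<p} \<inter> {q. W q = 0})"
      unfolding occ_def by (simp add: sum_of_bool_eq)
    also have "{..<p} \<inter> {q. W q = 0} = {q. q < p \<and> ?w ! q = 0}"
      using that by (auto simp: W_def)
    finally show ?thesis using that by (simp add: count_list_take_card)
  qed
  have zeros: "occ W 0 p = part a (W p)" if "W p \<noteq> 0" for p
    using occ[OF letter(1)[OF that]] before[OF letter(1)[OF that] letter(2)[OF that]] letter(3)[OF that]
    by simp
  have ex1: "\<exists>!p. W p = i" if i: "i \<in> {1..?n}" for i
  proof -
    have "card {q. q < length ?w \<and> ?w ! q = i} = 1"
      using one[OF i] by (simp only: count_list_card)
    also have "{q. q < length ?w \<and> ?w ! q = i} = {q. W q = i}" using i by (auto simp: W_def)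
    finally obtain q where "{q. W q = i} = {q}" by (rule card_1_singletonE)
    then show ?thesis by (intro ex1I[of _ q]) blast+
  qed
  have "ascent_free W"
    unfolding ascent_free_def
  proof (intro allI impI)
    fix p assume p: "W p \<noteq> 0"
    show "W (Suc p) \<le> W p"
    proof (cases "W (Suc p) = 0")
      case False
      \<comment> \<open>No zero lies between neighbouring labels, so they are tied and the tie rule
        of the string applies.\<close>
      have "part a (W p) = part a (W (Suc p))" using zeros[OF p] zeros[OF False] p by simp
      then have "?w ! Suc p < ?w ! p"
        using decr[of "Suc p" p] letter[OF p] letter[OF False] by simp
      then show ?thesis using letter(3)[OF p] letter(3)[OF False] by simp
    qed simp
  qed
  moreover have "range W \<subseteq> insert 0 {1..?n}"
  proof
    fix y assume "y \<in> range W"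
    then obtain p where "y = W p" by auto
    then show "y \<in> insert 0 {1..?n}" using letter(2,3)[of p] by (cases "W p = 0") auto
  qed
  moreover have "0 \<notin> {1..?n}" by simp
  ultimately have "word {1..?n} (part a) W" using zeros ex1 unfolding word_def by blast
  then show ?thesis unfolding W_def .
qed

subsection \<open>Columns and extendability\<close>

text \<open>\<open>v p\<close> is the bottom edge of row \<open>p\<close>, counted from 0. The
  column has no upper end; the zero top boundary becomes the vanishing of \<open>v\<close> from
  height \<open>N\<close> on, which forces zero tiles there (\<open>column_zero\<close>).\<close>

definition column :: "nat \<Rightarrow> (nat \<Rightarrow> nat) \<Rightarrow> nat \<Rightarrow> (nat \<Rightarrow> nat) \<Rightarrow> (nat \<Rightarrow> nat) \<Rightarrow> (nat \<Rightarrow> nat) \<Rightarrow> bool"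
  where "column n \<sigma> N v W W' \<longleftrightarrow>
    (\<forall>p. Tile (W p) (v (Suc p)) (v p) (W' p) \<in> tiles n \<sigma>) \<and> (\<forall>p\<ge>N. v p = 0)"

text \<open>Comparing the left with the bottom label selects the tile pattern and thereby the top
  label, so no choice remains once \<open>s\<close> enters at the bottom.\<close>

primrec vert :: "nat \<Rightarrow> (nat \<Rightarrow> nat) \<Rightarrow> (nat \<Rightarrow> nat) \<Rightarrow> nat \<Rightarrow> nat" where
  "vert s W W' 0 = s"
| "vert s W W' (Suc p) = (if W p = vert s W W' p then W' p else vert s W W' p)"

lemma column_eq_vert:
  assumes "\<And>q. q < p \<Longrightarrow> Tile (W q) (v (Suc q)) (v q) (W' q) \<in> tiles n \<sigma>"
  shows "v p = vert (v 0) W W' p"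
  using assms
proof (induction p)
  case (Suc p)
  then have "v p = vert (v 0) W W' p" by simp
  then show ?case using Suc.prems[of p] by (auto simp: Tile_in_tiles_iff)
qed simp

text \<open>Each tile balances left and top against bottom and right; summed over rows, the inner
  vertical edges cancel.\<close>

lemma occ_conservation:
  assumes "\<And>q. q < p \<Longrightarrow> Tile (W q) (v (Suc q)) (v q) (W' q) \<in> tiles n \<sigma>"
  shows "occ W k p + of_bool (v p = k) = of_bool (v 0 = k) + occ W' k p"
  using assms
proof (induction p)
  case (Suc p)
  then have IH: "occ W k p + of_bool (v p = k) = of_bool (v 0 = k) + occ W' k p" by simp
  have "W p = v p \<and> v (Suc p) = W' p \<or> W p = W' p \<and> v (Suc p) = v p"
    using Suc.prems[of p] by (auto simp: Tile_in_tiles_iff)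
  then show ?case
  proof (elim disjE conjE)
    assume "W p = v p" "v (Suc p) = W' p"
    then show ?thesis using IH by simp
  next
    assume "W p = W' p" "v (Suc p) = v p"
    then show ?thesis using IH by simp
  qed
qed simp

section \<open>Columns between strings are extension steps\<close>

text \<open>Stated for labels instead of positions, and once for each ordered pair, so that the
  cases \<open>l\<close>, \<open>r\<close> of \<open>extendable\<close> merge; see
  \<open>extendable_iff_extends\<close>.\<close>

definition extends :: "nat set \<Rightarrow> (nat \<Rightarrow> nat) \<Rightarrow> (nat \<Rightarrow> nat) \<Rightarrow> (nat \<Rightarrow> nat) \<Rightarrow> bool" where
  "extends L \<sigma> b a \<longleftrightarrow> (\<forall>i\<in>L. b i \<le> a i) \<and>
     (\<forall>i\<in>L. \<forall>j\<in>L. precedes a a i j \<longrightarrow>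
        (precedes b b i j \<longrightarrow> precedes a b i j) \<and>
        (precedes b b j i \<longrightarrow> a i = b i \<and> \<sigma> j < \<sigma> i))"

text \<open>Conservation locates each label on the vertical edges. If \<open>i\<close> lies below
  \<open>j\<close> on the left, then either \<open>j\<close> stays above the old row of
  \<open>i\<close>, or it crosses that row, where the crossing tile keeps \<open>i\<close> in place
  and yields the inequality for \<open>\<sigma>\<close>.\<close>

lemma column_word:
  assumes col: "column n \<sigma> N v W W'" and w: "word L a W" and af: "ascent_free W'"
    and s: "v 0 \<in> L" and min: "\<And>i. i \<in> L \<Longrightarrow> i \<noteq> v 0 \<Longrightarrow> \<sigma> (v 0) < \<sigma> i"
  obtains b where "word (L - {v 0}) b W'" "\<And>i. i \<notin> L - {v 0} \<Longrightarrow> b i = 0" "extends L \<sigma> b a"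
proof -
  let ?s = "v 0"
  have tile: "Tile (W p) (v (Suc p)) (v p) (W' p) \<in> tiles n \<sigma>" for p
    using col by (simp add: column_def)
  note cons = occ_conservation[of _ W v W', OF tile]
  have vN: "v p = 0" if "p \<ge> N" for p using col that by (simp add: column_def)
  have L0: "i \<noteq> 0" if "i \<in> L" for i using word_nonzero[OF w that] .
  note s0 = L0[OF s]
  have total: "occ W k p = of_bool (?s = k) + occ W' k p" if "p \<ge> N" "k \<noteq> 0" for k p
    using cons[of k p] vN[OF that(1)] that(2) by simp
  have occ_notin: "occ W k p = 0" if "k \<notin> L" "k \<noteq> 0" for k p
    using occ_pos_iff[of W k p] word_mem[OF w] that by (metis gr0I)
  have occW: "occ W k p = of_bool (row W k < p)" if "k \<in> L" for k p
    using occ_row[OF w that] .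
  \<comment> \<open>A label on the right is balanced by one on the left. The pivot enters from
    below, which already balances its only occurrence on the left.\<close>
  have memW': "W' p \<in> L - {?s}" if p: "W' p \<noteq> 0" for p
  proof -
    define M where "M = max N (Suc p)"
    have "0 < occ W' (W' p) M" unfolding occ_pos_iff M_def by (intro exI[of _ p]) auto
    then have pos: "occ W (W' p) M \<ge> of_bool (?s = W' p) + 1"
      using total[OF _ p, of M] by (simp add: M_def)
    then have "W' p \<in> L" using occ_notin[OF _ p, of M] by (cases "W' p \<in> L") simp_all
    moreover have "?s \<noteq> W' p" using pos occW[OF \<open>W' p \<in> L\<close>, of M] by (auto simp: of_bool_def split: if_splits)
    ultimately show ?thesis by auto
  qed
  have ex1: "\<exists>!p. W' p = i" if i: "i \<in> L - {?s}" for i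
  proof -
    have le1: "occ W' i p \<le> 1" for p
    proof -
      have "occ W' i p \<le> occ W' i (max N p)" by (intro occ_mono) simp
      also have "\<dots> \<le> occ W i (max N p)" using total[of "max N p" i] L0 i by simp
      also have "\<dots> \<le> 1" using occW i by simp
      finally show ?thesis .
    qed
    define M where "M = max N (Suc (row W i))"
    have "occ W i M = 1" using occW i by (simp add: M_def)
    then have "0 < occ W' i M" using total[of M i] i L0 by (simp add: M_def)
    then obtain p where p: "W' p = i" by (auto simp: occ_pos_iff)
    moreover have "q = p" if q: "W' q = i" for q
    proof -
      have False if "x < y" "W' x = i" "W' y = i" for x y
        using occ_less[of x y W' i] occ_less[of y "Suc y" W' i] le1[of "Suc y"] that by simp
      then show ?thesis using p q by (cases p q rule: linorder_cases) auto
    qed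
    ultimately show ?thesis by blast
  qed
  \<comment> \<open>The value 0 at the pivot \<open>?s\<close> matches the zero inserted by the
    covering relation.\<close>
  define b where "b i = (if i \<in> L - {?s} then occ W' 0 (row W' i) else 0)" for i
  have row: "row W' (W' p) = p" if "W' p \<noteq> 0" for p
    unfolding row_def using ex1[OF memW'[OF that]] by (intro the1_equality) auto
  have w': "word (L - {?s}) b W'"
  proof -
    have "0 \<notin> L - {?s}" using L0 by auto
    moreover have "range W' \<subseteq> insert 0 (L - {?s})"
    proof
      fix y assume "y \<in> range W'"
      then obtain p where "y = W' p" by auto
      then show "y \<in> insert 0 (L - {?s})" using memW'[of p] by (cases "W' p = 0") auto
    qed
    moreover have "\<forall>p. W' p \<noteq> 0 \<longrightarrow> occ W' 0 p = b (W' p)"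
      using memW' row by (simp add: b_def)
    ultimately show ?thesis using ex1 af unfolding word_def by blast
  qed
  let ?R = "row W" and ?R' = "row W'"
  have W_R: "W (?R i) = i" if "i \<in> L" for i using word_row[OF w that] .
  have W'_R': "W' (?R' i) = i" if "i \<in> L - {?s}" for i using word_row[OF w' that] .
  have a: "a i = occ W 0 (?R i)" if "i \<in> L" for i
    using word_occ[OF w, of "?R i"] W_R[OF that] L0[OF that] by simp
  have b: "b i = occ W' 0 (?R' i)" if "i \<in> L - {?s}" for i
    using that by (simp add: b_def)
  \<comment> \<open>A label other than the pivot occupies exactly the vertical edges between its new
    row and its old row.\<close>
  have v_iff: "v p = i \<longleftrightarrow> ?R' i < p \<and> p \<le> ?R i" if i: "i \<in> L - {?s}" for i p
    using cons[of i p] occW[of i p] occ_row[OF w' i, of p] i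
    by (cases "?R i < p"; cases "?R' i < p"; cases "v p = i") auto
  have v_s: "v p = ?s \<longleftrightarrow> p \<le> ?R ?s" for p
  proof -
    have "occ W' ?s p = 0" using occ_pos_iff[of W' ?s p] memW' s0 by (metis DiffE gr0I singletonI)
    then show ?thesis using cons[of ?s p] occW[OF s, of p]
      by (cases "?R ?s < p"; cases "v p = ?s") auto
  qed
  have R'_le: "?R' i \<le> ?R i" if i: "i \<in> L - {?s}" for i
    using cons[of i "Suc (?R i)"] occW[of i "Suc (?R i)"] occ_row[OF w' i, of "Suc (?R i)"] i
    by (cases "?R' i < Suc (?R i)") auto
  have zero: "occ W 0 p + of_bool (v p = 0) = occ W' 0 p" for p
    using cons[of 0 p] s0 by simp
  have v_R: "v (?R i) \<noteq> 0" if "i \<in> L" for i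
    using tile[of "?R i"] W_R[OF that] L0[OF that] by (auto simp: Tile_in_tiles_iff)
  \<comment> \<open>The two zero counts differ only where the vertical edge is empty, which it is
    not below a row with a label on the left. So \<open>a\<close> and \<open>b\<close> can both be
    read off from \<open>W'\<close>.\<close>
  have a': "a i = occ W' 0 (?R i)" if "i \<in> L" for i
    using zero[of "?R i"] v_R[OF that] a[OF that] by simp
  \<comment> \<open>Zero counts in \<open>W'\<close> give the weak inequality. Equality means no
    zero between the two rows, and then \<open>W'\<close> descends there from at most
    \<open>i\<close> to \<open>j\<close>.\<close>
  have before: "precedes a b i j" if i: "i \<in> L" and j: "j \<in> L - {?s}" and le: "?R i \<le> ?R' j" and "i \<noteq> j"
    for i j
  proof (cases "a i < b j")
    case False
    have "a i \<le> b j" unfolding a'[OF i] b[OF j] using le by (rule occ_mono)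
    then have eq: "occ W' 0 (?R i) = occ W' 0 (?R' j)" using False a'[OF i] b[OF j] by simp
    have nz: "W' q \<noteq> 0" if "?R i \<le> q" "q \<le> ?R' j" for q
    proof (cases "q = ?R' j")
      case True
      then show ?thesis using W'_R'[OF j] L0 j by simp
    next
      case False
      then show ?thesis using occ_eq_imp_neq[OF eq that(1)] that(2) by simp
    qed
    have "j \<le> W' (?R i)"
      using ascent_free_less[OF af le nz] W'_R'[OF j] by simp
    moreover have "W' (?R i) \<le> i"
      using tile[of "?R i"] W_R[OF i] L0[OF i] by (auto simp: Tile_in_tiles_iff)
    ultimately have "j < i" using \<open>i \<noteq> j\<close> by simp
    moreover have "a i = b j" using False \<open>a i \<le> b j\<close> by simp
    ultimately show ?thesis by (simp add: precedes_def)
  qed (simp add: precedes_def)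
  have cross: "a i = b i \<and> \<sigma> j < \<sigma> i" if i: "i \<in> L" and j: "v (?R i) = j" "j \<in> L" "j \<noteq> i" for i j
  proof -
    have "W' (?R i) = i" and \<sigma>: "\<sigma> j < \<sigma> i"
      using tile[of "?R i"] W_R[OF i] L0[OF i] j by (auto simp: Tile_in_tiles_iff)
    then have "i \<in> L - {?s}" "?R' i = ?R i"
      using memW'[of "?R i"] row[of "?R i"] L0[OF i] by simp_all
    then have "a i = b i" using a'[OF i] b by simp
    with \<sigma> show ?thesis by simp
  qed
  have "b i \<le> a i" if i: "i \<in> L" for i
  proof (cases "i = ?s")
    case False
    then show ?thesis unfolding a'[OF i] using b[of i] occ_mono[OF R'_le[of i]] i by simp
  qed (simp add: b_def)
  moreover have "(precedes b b i j \<longrightarrow> precedes a b i j) \<and>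
    (precedes b b j i \<longrightarrow> a i = b i \<and> \<sigma> j < \<sigma> i)"
    if i: "i \<in> L" and j: "j \<in> L" and ij: "precedes a a i j" for i j
  proof -
    have neq: "i \<noteq> j" using ij by (auto simp: precedes_def)
    have R: "?R i < ?R j"
      using word_precedes_iff[OF w, of "?R i" "?R j"] W_R i j L0 ij by simp
    \<comment> \<open>The pivot has no new row: it fills all vertical edges up to its old row. So it
      crosses every label below it, and no other label descends to or past its old row.\<close>
    consider "j = ?s" | "i = ?s" | "i \<in> L - {?s}" "j \<in> L - {?s}" using i j by auto
    then show ?thesis
    proof cases
      case 1
      have v: "v (?R i) = j" using v_s[of "?R i"] R 1 by simp
      have "a i = b i \<and> \<sigma> j < \<sigma> i" using cross[OF i v j] neq by simp
      then show ?thesis using 1 by (auto simp: precedes_def b_def)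
    next
      case 2
      then have j': "j \<in> L - {?s}" using j neq by simp
      have "?R i \<le> ?R' j"
      proof (rule ccontr)
        assume "\<not> ?R i \<le> ?R' j"
        then have "v (?R i) = j" using v_iff[OF j', of "?R i"] R by simp
        then show False using v_s[of "?R i"] 2 neq by simp
      qed
      then have "precedes a b i j" using before[OF i j' _ neq] by simp
      then show ?thesis using 2 by (auto simp: precedes_def b_def)
    next
      case 3
      show ?thesis
      proof (cases "?R i \<le> ?R' j")
        case True
        then have "?R' i \<le> ?R' j" using R'_le[OF 3(1)] by simp
        moreover have "?R' i \<noteq> ?R' j" using W'_R'[OF 3(1)] W'_R'[OF 3(2)] neq by metis
        ultimately have "precedes b b i j"
          using word_precedes_iff[OF w', of "?R' i" "?R' j"] W'_R'[OF 3(1)] W'_R'[OF 3(2)] L0 i j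
          by simp
        then show ?thesis using before[OF i 3(2) True neq] precedes_asym by blast
      \<comment> \<open>Here \<open>j\<close> descends past the old row of \<open>i\<close>, so it
        crosses \<open>i\<close> and ends below it.\<close>
      next
        case False
        then have v: "v (?R i) = j" using v_iff[OF 3(2), of "?R i"] R by simp
        have c: "a i = b i \<and> \<sigma> j < \<sigma> i" using cross[OF i v j] neq by simp
        have "W' (?R i) = i"
          using tile[of "?R i"] W_R[OF i] L0[OF i] v neq by (auto simp: Tile_in_tiles_iff)
        then have "?R' i = ?R i" using row[of "?R i"] L0[OF i] by simp
        then have "precedes b b j i"
          using word_precedes_iff[OF w', of "?R' j" "?R' i"] W'_R'[OF 3(1)] W'_R'[OF 3(2)] L0 i j False
          by simp
        then show ?thesis using c precedes_asym by blast
      qed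
    qed
  qed
  ultimately have "extends L \<sigma> b a" unfolding extends_def by blast
  then show ?thesis using w' by (intro that[of b]) (auto simp: b_def)
qed

text \<open>Tiles are verified from the bottom up: validity below row \<open>p\<close> gives
  conservation up to \<open>p\<close>, hence the location of every label relative to
  \<open>p\<close>, and \<open>extends\<close> excludes each illegal choice of the next
  tile.\<close>

lemma extends_column:
  assumes w: "word L a W" and w': "word (L - {s}) b W'" and s: "s \<in> L" and bs: "b s = 0"
    and L: "L \<subseteq> {1..n}" and ext: "extends L \<sigma> b a"
    and min: "\<And>i. i \<in> L \<Longrightarrow> i \<noteq> s \<Longrightarrow> \<sigma> s < \<sigma> i"
    and N: "\<And>p. p \<ge> N \<Longrightarrow> W p = 0"
  shows "column n \<sigma> N (vert s W W') W W'"
proof -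
  let ?v = "vert s W W'" and ?R = "row W" and ?R' = "row W'"
  have L0: "i \<noteq> 0" "i \<le> n" if "i \<in> L" for i using L that by auto
  have W_R: "W (?R i) = i" if "i \<in> L" for i using word_row[OF w that] .
  have W'_R': "W' (?R' i) = i" if "i \<in> L - {s}" for i using word_row[OF w' that] .
  have a: "a i = occ W 0 (?R i)" if "i \<in> L" for i
    using word_occ[OF w, of "?R i"] W_R[OF that] L0[OF that] by simp
  have b: "b i = occ W' 0 (?R' i)" if "i \<in> L - {s}" for i
    using word_occ[OF w', of "?R' i"] W'_R'[OF that] L0[of i] that by simp
  have ba: "b i \<le> a i" if "i \<in> L" for i using ext that by (simp add: extends_def)
  have extD: "precedes a b i j \<or> precedes b b j i \<and> a i = b i \<and> \<sigma> j < \<sigma> i"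
    if "i \<in> L" "j \<in> L" "?R i < ?R j" for i j
  proof -
    have "precedes a a i j"
      using word_precedes_iff[OF w, of "?R i" "?R j"] W_R L0 that by simp
    moreover from this have "precedes b b i j \<or> precedes b b j i"
      using precedes_total[of i j b] by (auto simp: precedes_def)
    ultimately show ?thesis using ext that unfolding extends_def by blast
  qed
  have row_a: "a i < a j \<or> a i = a j \<and> j < i" if "i \<in> L" "j \<in> L" "?R i < ?R j" for i j
    using word_precedes_iff[OF w, of "?R i" "?R j"] W_R L0 that by (simp add: precedes_def)
  have row_b: "precedes b b i j" if "i \<in> L - {s}" "j \<in> L - {s}" "?R' i < ?R' j" for i j
    using word_precedes_iff[OF w', of "?R' i" "?R' j"] W'_R' L0 that by simp
  have row_b_s: "b i = 0 \<and> \<sigma> s < \<sigma> i" if "precedes b b i s" "i \<in> L" for i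
    using that bs min by (auto simp: precedes_def)
  have v_mem: "?v p \<in> insert 0 L" for p
  proof (induction p)
    case (Suc p)
    then show ?case using word_mem[OF w', of p] by auto
  qed (simp add: s)
  have occ_s: "occ W' s p = 0" for p
    using occ_pos_iff[of W' s p] word_mem[OF w'] L0(1)[OF s] by (metis DiffE gr0I singletonI)
  have tile: "Tile (W p) (?v (Suc p)) (?v p) (W' p) \<in> tiles n \<sigma>" for p
  proof (induction p rule: less_induct)
    case (less p)
    have cons: "occ W k p + of_bool (?v p = k) = of_bool (s = k) + occ W' k p" for k
      using occ_conservation[of p W ?v W' n \<sigma> k] less by simp
    have iff: "(?R i < p \<or> ?v p = i) \<longleftrightarrow> ?R' i < p" "\<not> (?R i < p \<and> ?v p = i)"
      if "i \<in> L - {s}" for i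
      using cons[of i] occ_row[OF w, of i p] occ_row[OF w' that, of p] that
      by (cases "?R i < p"; cases "?v p = i"; cases "?R' i < p"; auto)+
    have iff_s: "?v p = s \<longleftrightarrow> p \<le> ?R s"
      using cons[of s] occ_row[OF w s, of p] occ_s[of p] by (cases "?R s < p"; cases "?v p = s") auto
    have z: "occ W' 0 p = occ W 0 p + of_bool (?v p = 0)" using cons[of 0] L0[OF s] by simp
    have right: "?R' (W' p) = p" "W' p \<in> L - {s}" "W' p \<in> L" "b (W' p) = occ W' 0 p" "W' p \<le> n"
      if "W' p \<noteq> 0"
      using row_eq[OF w' refl that] word_mem[OF w' that] word_occ[OF w' that] L0 by auto
    have left: "?R (W p) = p" "W p \<in> L" "a (W p) = occ W 0 p" "W p \<le> n" if "W p \<noteq> 0"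
      using row_eq[OF w refl that] word_mem[OF w that] word_occ[OF w that] L0 by auto
    have a_ge: "occ W 0 p \<le> a i" if "i \<in> L" "p \<le> ?R i" for i
      using a[OF that(1)] occ_mono[OF that(2), of W 0] by simp
    have b_ge: "occ W' 0 p \<le> b i" if "i \<in> L - {s}" "p \<le> ?R' i" for i
      using b[OF that(1)] occ_mono[OF that(2), of W' 0] by simp
    have b_le: "b i \<le> occ W' 0 p" if "i \<in> L" "i = s \<or> ?R' i < p" for i
      using b[of i] occ_mono[of "?R' i" p W' 0] that bs by (cases "i = s") auto
    show ?case
    proof (cases "?v p = 0")
      case True
      \<comment> \<open>A label of \<open>W\<close> in this row would lie at or above it in
        \<open>W'\<close>, with one more zero before it there, so its value would grow, against
        \<open>b i \<le> a i\<close>.\<close>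
      have "W p = 0"
      proof (rule ccontr)
        assume nz: "W p \<noteq> 0"
        note l = left[OF nz]
        have "W p \<noteq> s" using iff_s True L0[OF s] l(1) by auto
        then have i: "W p \<in> L - {s}" using l by simp
        have "p \<le> ?R' (W p)" using iff(1)[OF i] True L0(1)[OF l(2)] l(1) by auto
        then have "occ W' 0 p \<le> b (W p)" using b_ge[OF i] by simp
        then show False using ba[OF l(2)] l(3) z True by simp
      qed
      moreover have "W' p \<le> n" using right(5) by (cases "W' p = 0") auto
      ultimately show ?thesis using True by (simp add: Tile_in_tiles_iff)
    next
      case False
      define f where "f = ?v p"
      have f: "f \<in> L" "f \<noteq> 0" using v_mem[of p] False by (auto simp: f_def)
      have f_out: "f = s \<or> ?R' f < p" using iff(1)[of f] f by (auto simp: f_def)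
      have f_in: "p \<le> ?R f" using iff(2)[of f] iff_s f by (cases "f = s") (auto simp: f_def)
      have zz: "occ W' 0 p = occ W 0 p" using z False by simp
      have b_f: "b f \<le> occ W 0 p" using b_le[OF f(1) f_out] zz by simp
      have r_in: "p \<le> ?R (W' p)" "W' p \<noteq> f" if nz: "W' p \<noteq> 0"
      proof -
        note r = right[OF nz]
        show "p \<le> ?R (W' p)" using iff(1)[OF r(2)] r(1) by auto
        show "W' p \<noteq> f" using f_out r by auto
      qed
      \<comment> \<open>The vertical label \<open>f\<close> has its new row below \<open>p\<close>,
        so a label \<open>e\<close> from row \<open>p\<close> on in \<open>W'\<close> cannot come
        before it. Only the pivot escapes, having no new row; it has value 0 and minimal
        \<open>\<sigma>\<close>.\<close>
      have nb: "f = s \<and> \<sigma> f < \<sigma> e"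
        if "e \<in> L - {s}" "p \<le> ?R' e" "precedes b b e f" for e
        using row_b[of f e] that f f_out row_b_s[of e] precedes_asym[of b e f]
        by (cases "f = s") auto
      have strict: "p < ?R i" if "i \<in> L" "p \<le> ?R i" "i \<noteq> W p" for i
        using W_R[OF that(1)] that by (cases "?R i = p") auto
      consider "W p = 0" | "W p = f" | "W p \<noteq> 0" "W p \<noteq> f" by blast
      then show ?thesis
      proof cases
        case 1
        \<comment> \<open>Otherwise both \<open>f\<close> and \<open>W' p\<close> have old rows
          above this zero, hence \<open>a\<close>-values exceeding the current zero count, which
          bounds both \<open>b\<close>-values. Whichever of them comes first in \<open>a\<close>
          violates \<open>extends\<close>.\<close>
        have "W' p = 0"
        proof (rule ccontr)
          assume nz: "W' p \<noteq> 0"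
          define j where "j = W' p"
          have j: "j \<in> L" "j \<noteq> f" "b j = occ W 0 p" "p \<le> ?R j"
            using right[OF nz] r_in[OF nz] zz by (auto simp: j_def)
          have a_gt: "occ W 0 p < a i" if "i \<in> L" "p \<le> ?R i" for i
            using strict[OF that] L0[OF that(1)] 1 a[OF that(1)] occ_less[of p "?R i" W 0] by simp
          have "?R f \<noteq> ?R j" using W_R[OF f(1)] W_R[OF j(1)] j(2) by metis
          then consider "?R f < ?R j" | "?R j < ?R f" by linarith
          then show False
          proof cases
            case 1
            show False using extD[OF f(1) j(1) 1] a_gt[OF f(1) f_in] j(3) b_f
              by (auto simp: precedes_def)
          next
            case 2
            show False using extD[OF j(1) f(1) 2] a_gt[OF j(1,4)] j(3) b_f
              by (auto simp: precedes_def)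
          qed
        qed
        then show ?thesis using 1 f L0[OF f(1)] by (simp add: Tile_in_tiles_iff flip: f_def)
      next
        case 2
        have "W' p \<le> f"
        proof (cases "W' p = 0")
          case False
          define e where "e = W' p"
          have e: "e \<in> L - {s}" "e \<in> L" "e \<noteq> f" "b e = occ W 0 p" "p \<le> ?R e" "?R' e = p"
            using right[OF False] r_in[OF False] zz by (auto simp: e_def)
          have f': "?R f = p" "a f = occ W 0 p" using left 2 f by auto
          have "?R f < ?R e" using strict[OF e(2,5)] e(3) 2 f' by simp
          \<comment> \<open>The alternative, that \<open>e\<close> jumps over \<open>f\<close>,
            needs \<open>\<sigma> e < \<sigma> f\<close>, while \<open>nb\<close> gives the
            opposite.\<close>
          from extD[OF f(1) e(2) this] have "precedes a b f e"
            using nb[OF e(1)] e(6) by auto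
          then show ?thesis using f' e(4) by (simp add: precedes_def flip: e_def)
        qed simp
        then show ?thesis using 2 L0[OF f(1)] by (auto simp: Tile_in_tiles_iff simp flip: f_def)
      next
        case 3
        define g where "g = W p"
        have g: "?R g = p" "g \<in> L" "a g = occ W 0 p" "g \<le> n" "g \<noteq> 0" "g \<noteq> f"
          using left[OF 3(1)] 3 by (auto simp: g_def)
        have gs: "g \<in> L - {s}" using iff_s g by (auto simp: f_def)
        have R'g: "p \<le> ?R' g" using iff(1)[OF gs] g by (auto simp: f_def)
        \<comment> \<open>The new row of \<open>g\<close> is not below its old row \<open>p\<close>,
          and the zero counts agree there, so the value cannot have dropped.\<close>
        have bg: "b g = a g" using b_ge[OF gs R'g] zz ba[OF g(2)] g(3) by simp
        have Rf: "?R g < ?R f" using strict[OF f(1) f_in] g by (simp add: g_def)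
        have \<sigma>: "\<sigma> f < \<sigma> g"
        proof (cases "precedes a b g f")
          case True
          then have "precedes b b g f" using bg by (simp add: precedes_def)
          then show ?thesis using nb[OF gs R'g] by blast
        next
          case False
          then show ?thesis using extD[OF g(2) f(1) Rf] by simp
        qed
        \<comment> \<open>A zero here would raise the value of \<open>g\<close>. Another label
          \<open>e\<close> would be tied with \<open>g\<close> in \<open>b\<close>, hence larger
          than \<open>g\<close>; each order of \<open>f\<close> and \<open>e\<close> in the old word
          then contradicts \<open>extends\<close>.\<close>
        have "W' p = g"
        proof (rule ccontr)
          assume ng: "W' p \<noteq> g"
          then have "p < ?R' g" using R'g W'_R'[OF gs] by (cases "?R' g = p") auto
          show False
          proof (cases "W' p = 0")
            case True
            then show False using occ_less[OF \<open>p < ?R' g\<close>, of W' 0] b[OF gs] bg g(3) zz by simp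
          next
            case False
            define e where "e = W' p"
            have e: "e \<in> L - {s}" "e \<in> L" "e \<noteq> f" "b e = occ W 0 p" "p \<le> ?R e" "?R' e = p"
              using right[OF False] r_in[OF False] zz by (auto simp: e_def)
            have "g < e"
              using row_b[OF e(1) gs] e(6) \<open>p < ?R' g\<close> e(4) bg g(3) by (simp add: precedes_def)
            have Re: "?R g < ?R e" using strict[OF e(2,5)] ng g(1) by (simp add: e_def g_def)
            have "?R f \<noteq> ?R e" using W_R[OF f(1)] W_R[OF e(2)] e(3) by metis
            then consider "?R f < ?R e" | "?R e < ?R f" by linarith
            then show False
            proof cases
              case 1
              have "precedes a b f e" using extD[OF f(1) e(2) 1] nb[OF e(1)] e(6) by auto
              then show False
                using row_a[OF g(2) f(1) Rf] g(3) e(4) \<open>g < e\<close> unfolding precedes_def by linarith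
            next
              case 2
              then show False
                using extD[OF e(2) f(1) 2] row_a[OF g(2) e(2) Re] g(3) b_f e(4) \<open>g < e\<close>
                unfolding precedes_def by linarith
            qed
          qed
        qed
        then show ?thesis using g f L0[OF f(1)] \<sigma>
          by (simp add: Tile_in_tiles_iff flip: g_def f_def)
      qed
    qed
  qed
  \<comment> \<open>A label still vertical at this height has already occurred on the left. Together
    these count it twice, but the right side of the balance is at most one.\<close>
  have "?v p = 0" if p: "p \<ge> N" for p
  proof (rule ccontr)
    assume nz: "?v p \<noteq> 0"
    let ?k = "?v p"
    have k: "?k \<in> L" using v_mem[of p] nz by auto
    have "?R ?k < p" using N[of "?R ?k"] p W_R[OF k] L0[OF k] by force
    then have "occ W ?k p = 1" using occ_row[OF w k] by simp
    moreover have "occ W ?k p + 1 = of_bool (s = ?k) + occ W' ?k p"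
      using occ_conservation[of p W ?v W' n \<sigma> ?k] tile by simp
    moreover have "occ W' ?k p \<le> 1" if "?k \<noteq> s" using occ_row[OF w', of ?k p] k that by simp
    ultimately show False using occ_s[of p] by (cases "?k = s") auto
  qed
  with tile show ?thesis unfolding column_def by blast
qed

lemma column_zero:
  assumes "column n \<sigma> N v W W'" "p \<ge> N"
  shows "W p = 0" "W' p = 0"
proof -
  have "Tile (W p) (v (Suc p)) (v p) (W' p) \<in> tiles n \<sigma>"
    using assms(1) unfolding column_def by iprover
  moreover have "v p = 0" "v (Suc p) = 0" using assms by (simp_all add: column_def)
  ultimately show "W p = 0" "W' p = 0" by (auto simp: Tile_in_tiles_iff)
qed

section \<open>Ascents of right words\<close>

definition bad_ascent :: "(nat \<Rightarrow> nat) \<Rightarrow> (nat \<Rightarrow> nat) \<Rightarrow> bool" where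
  "bad_ascent \<sigma> W \<longleftrightarrow> (\<exists>p. W p \<noteq> 0 \<and> W p < W (Suc p) \<and> \<sigma> (W p) < \<sigma> (W (Suc p)))"

text \<open>The ascent stays in the same two rows: the upper label must go straight across, and the
  lower one can only be kept or replaced by a smaller label, whose \<open>\<sigma>\<close> the upper
  crossing bounds.\<close>

lemma column_bad_ascent:
  assumes "column n \<sigma> N v W W'" "bad_ascent \<sigma> W"
  shows "bad_ascent \<sigma> W'"
proof -
  have tile: "Tile (W p) (v (Suc p)) (v p) (W' p) \<in> tiles n \<sigma>" for p
    using assms(1) by (simp add: column_def)
  obtain p where "W p \<noteq> 0" "W p < W (Suc p)" "\<sigma> (W p) < \<sigma> (W (Suc p))"
    using assms(2) unfolding bad_ascent_def by blast
  then have "W' p \<noteq> 0 \<and> W' p < W' (Suc p) \<and> \<sigma> (W' p) < \<sigma> (W' (Suc p))"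
    using tile[of p] tile[of "Suc p"] by (auto simp: Tile_in_tiles_iff)
  then show ?thesis unfolding bad_ascent_def by blast
qed

text \<open>A new ascent needs a vertical label to turn right in row \<open>p\<close> while the
  label that enters above it is crossed in the next row; the crossing tile then compares the
  \<open>\<sigma>\<close>-values.\<close>

lemma column_ascent_bad:
  assumes "column n \<sigma> N v W W'" "ascent_free W" "\<not> ascent_free W'"
  shows "bad_ascent \<sigma> W'"
proof -
  have tile: "Tile (W p) (v (Suc p)) (v p) (W' p) \<in> tiles n \<sigma>" for p
    using assms(1) by (simp add: column_def)
  obtain p where p: "W' p \<noteq> 0" "W' p < W' (Suc p)"
    using assms(3) unfolding ascent_free_def by (meson not_le)
  have "W p \<noteq> 0 \<Longrightarrow> W (Suc p) \<le> W p" using assms(2) by (simp add: ascent_free_def)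
  with p have "\<sigma> (W' p) < \<sigma> (W' (Suc p))"
    using tile[of p] tile[of "Suc p"] by (auto simp: Tile_in_tiles_iff)
  with p show ?thesis unfolding bad_ascent_def by blast
qed

text \<open>Potential argument: the label on the vertical edge at height \<open>p\<close> is credited with the zeros
  it has already passed, so that each unit of weight raises the left-hand side by one.\<close>

lemma column_weight_aux:
  assumes tile: "\<And>p. Tile (W p) (v (Suc p)) (v p) (W' p) \<in> tiles n \<sigma>" and "v 0 \<noteq> 0"
  shows "(\<Sum>q<p. of_bool (W q \<noteq> 0) * occ W 0 q) + of_bool (v p \<noteq> 0) * occ W 0 p =
    (\<Sum>q<p. of_bool (W' q \<noteq> 0) * occ W' 0 q) + (\<Sum>q<p. of_bool (W q = 0 \<and> v q \<noteq> 0))"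
proof (induction p)
  case (Suc p)
  have "occ W' 0 p = occ W 0 p + of_bool (v p = 0)"
    using occ_conservation[of p W v W' n \<sigma> 0] assms by simp
  then show ?case
    using Suc tile[of p] by (cases "W p = 0"; cases "v p = 0") (auto simp: Tile_in_tiles_iff)
qed simp

text \<open>Evaluates the boundary sums of \<open>column_weight_aux\<close>, one term per
  label.\<close>

lemma word_sum:
  assumes w: "word L f W" and N: "\<And>p. p \<ge> N \<Longrightarrow> W p = 0"
  shows "(\<Sum>q<N. of_bool (W q \<noteq> 0) * occ W 0 q) = sum f L"
proof -
  have "(\<Sum>q<N. of_bool (W q \<noteq> 0) * occ W 0 q) = (\<Sum>q\<in>{q. q < N \<and> W q \<noteq> 0}. occ W 0 q)"
    by (intro sum.mono_neutral_cong_right) auto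
  also have "\<dots> = sum f L"
  proof (rule sum.reindex_bij_witness[of _ "row W" W])
    fix q assume q: "q \<in> {q. q < N \<and> W q \<noteq> 0}"
    then have nz: "W q \<noteq> 0" by simp
    show "row W (W q) = q" using row_eq[OF w refl nz] .
    show "W q \<in> L" using word_mem[OF w nz] .
    show "f (W q) = occ W 0 q" using word_occ[OF w nz] by simp
  next
    fix i assume i: "i \<in> L"
    show W: "W (row W i) = i" using word_row[OF w i] .
    show "row W i \<in> {q. q < N \<and> W q \<noteq> 0}"
      using N[of "row W i"] W word_nonzero[OF w i] by (auto simp: not_less[symmetric])
  qed
  finally show ?thesis .
qed

text \<open>The last sum counts the tiles of weight \<open>x\<close>, so the exponent contributed by
  a column is the loss of total size.\<close>

lemma column_weight:
  assumes col: "column n \<sigma> N v W W'" and "v 0 \<noteq> 0" and w: "word L a W" and w': "word L' b W'"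
  shows "sum a L = sum b L' + (\<Sum>q<N. of_bool (W q = 0 \<and> v q \<noteq> 0))"
  using column_weight_aux[of W v W' n \<sigma> N] col \<open>v 0 \<noteq> 0\<close>
    word_sum[OF w column_zero(1)[OF col]] word_sum[OF w' column_zero(2)[OF col]]
  by (simp add: column_def)

lemma ex_word:
  assumes "finite L" "0 \<notin> L"
  shows "\<exists>W. word L f W"
proof -
  let ?l = "sorted_list_of_set L"
  define e where "e i = (if i = 0 then 0 else ?l ! (i - 1))" for i
  have len: "length ?l = card L" by simp
  have img: "e ` {1..card L} = L"
  proof -
    have "e ` {1..card L} = (!) ?l ` {..<card L}"
    proof (intro equalityI subsetI)
      fix y assume "y \<in> (!) ?l ` {..<card L}"
      then obtain k where "k < card L" "y = ?l ! k" by auto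
      then have "Suc k \<in> {1..card L}" "y = e (Suc k)" by (auto simp: e_def)
      then show "y \<in> e ` {1..card L}" by blast
    qed (auto simp: e_def)
    also have "\<dots> = set ?l" unfolding set_conv_nth len by auto
    finally show ?thesis using assms by simp
  qed
  have "strict_mono_on {0..card L} e"
  proof (rule strict_mono_onI)
    fix i j assume ij: "i \<in> {0..card L}" "j \<in> {0..card L}" "i < j"
    show "e i < e j"
    proof (cases "i = 0")
      case True
      have "e j \<in> L" using ij img by auto
      with True assms show ?thesis by (auto simp: e_def intro: gr0I)
    next
      case False
      have "sorted_wrt (<) ?l" by simp
      then show ?thesis using False ij by (auto simp: e_def sorted_wrt_iff_nth_less)
    qed
  qed
  moreover have "word {1..card L} (part (map f ?l))
      (\<lambda>p. if p < length (star (map f ?l)) then star (map f ?l) ! p else 0)"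
    using word_star[of "map f ?l"] by simp
  ultimately have "\<exists>V. word (e ` {1..card L}) f (e \<circ> V)"
    by (intro exI, elim word_relabel[rotated]) (auto simp: e_def part_def)
  then show ?thesis unfolding img by blast
qed

subsection \<open>Compositions as functions on the remaining labels\<close>

text \<open>Column \<open>c\<close> absorbs the label \<open>inv \<sigma> c\<close>, so these are
  the labels left after \<open>c\<close> columns. In increasing order they index the parts of a
  composition of length \<open>n - c\<close>.\<close>

definition labels :: "nat \<Rightarrow> (nat \<Rightarrow> nat) \<Rightarrow> nat \<Rightarrow> nat list" where
  "labels n \<sigma> c = filter (\<lambda>i. c < \<sigma> i) [1..<Suc n]"

lemma labels_0:
  assumes "\<sigma> permutes {1..n}"
  shows "labels n \<sigma> 0 = [1..<Suc n]"
  unfolding labels_def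
proof (intro filter_True ballI)
  fix i assume "i \<in> set [1..<Suc n]"
  then have "\<sigma> i \<in> {1..n}" using permutes_in_image[OF assms, of i] by auto
  then show "0 < \<sigma> i" by simp
qed

text \<open>Hence the \<open>c\<close>-th reduced permutation compares positions as
  \<open>\<sigma>\<close> compares the labels there.\<close>

lemma delete_one_iter:
  assumes "\<sigma> permutes {1..n}"
  shows "(delete_one ^^ c) (one_line n \<sigma>) = map (\<lambda>i. \<sigma> i - c) (labels n \<sigma> c)"
proof (induction c)
  case 0
  show ?case using labels_0[OF assms] by (simp add: one_line_def del: upt_Suc)
next
  case (Suc c)
  have "(delete_one ^^ Suc c) (one_line n \<sigma>) = delete_one (map (\<lambda>i. \<sigma> i - c) (labels n \<sigma> c))"
    using Suc by simp
  also have "\<dots> = map (\<lambda>i. \<sigma> i - Suc c) (filter (\<lambda>i. \<sigma> i - c \<noteq> 1) (labels n \<sigma> c))"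
    by (simp add: delete_one_def filter_map o_def)
  also have "filter (\<lambda>i. \<sigma> i - c \<noteq> 1) (labels n \<sigma> c) = labels n \<sigma> (Suc c)"
    unfolding labels_def filter_filter by (rule filter_cong) auto
  finally show ?case .
qed

lemma set_labels: "set (labels n \<sigma> c) = {i \<in> {1..n}. c < \<sigma> i}"
  unfolding labels_def by auto

lemma sorted_labels: "sorted_wrt (<) (labels n \<sigma> c)"
  unfolding labels_def by (rule sorted_wrt_filter) (rule sorted_wrt_upt)

lemma distinct_labels: "distinct (labels n \<sigma> c)"
  unfolding labels_def by simp

lemma length_labels:
  assumes "\<sigma> permutes {1..n}"
  shows "length (labels n \<sigma> c) = n - c"
proof -
  have "\<sigma> ` set (labels n \<sigma> c) = {c<..n}"
  proof -
    have "\<sigma> ` set (labels n \<sigma> c) = \<sigma> ` {1..n} \<inter> {c<..}" unfolding set_labels by blast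
    also have "\<dots> = {c<..n}" unfolding permutes_image[OF assms] by auto
    finally show ?thesis .
  qed
  moreover have "inj_on \<sigma> (set (labels n \<sigma> c))"
    using permutes_inj[OF assms] by (rule inj_on_subset) simp
  ultimately have "card (set (labels n \<sigma> c)) = card {c<..n}" by (metis card_image)
  then show ?thesis by (simp add: distinct_card[OF distinct_labels])
qed

text \<open>The label entering the next column is the one removed from the label set, and it
  minimises \<open>\<sigma>\<close> on the labels left before that column.\<close>

lemma pivot:
  assumes "\<sigma> permutes {1..n}" "c < n"
  shows "\<sigma> (inv \<sigma> (Suc c)) = Suc c" "inv \<sigma> (Suc c) \<in> set (labels n \<sigma> c)"
    "set (labels n \<sigma> (Suc c)) = set (labels n \<sigma> c) - {inv \<sigma> (Suc c)}"
proof -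
  let ?s = "inv \<sigma> (Suc c)"
  show s: "\<sigma> ?s = Suc c" using permutes_inverses(1)[OF assms(1)] .
  have "?s \<in> {1..n}" using permutes_in_image[OF permutes_inv[OF assms(1)], of "Suc c"] assms(2) by simp
  then show "?s \<in> set (labels n \<sigma> c)" using s by (simp add: set_labels)
  have "\<sigma> i = Suc c \<longleftrightarrow> i = ?s" for i using permutes_inv_eq[OF assms(1), of "Suc c" i] by auto
  moreover have "Suc c < \<sigma> i \<longleftrightarrow> c < \<sigma> i \<and> \<sigma> i \<noteq> Suc c" for i by linarith
  ultimately show "set (labels n \<sigma> (Suc c)) = set (labels n \<sigma> c) - {?s}"
    unfolding set_labels by blast
qed

lemma sigma_seq_nth:
  assumes "\<sigma> permutes {1..n}" "k < n - c"
  shows "sigma_seq n \<sigma> c (Suc k) = \<sigma> (labels n \<sigma> c ! k) - c"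
  using assms length_labels[OF assms(1), of c]
  by (simp add: sigma_seq_def delete_one_iter of_one_line_def part_def)

lemma inv_sigma_seq:
  assumes \<sigma>: "\<sigma> permutes {1..n}" and "labels n \<sigma> c ! k = inv \<sigma> (Suc c)" and k: "k < n - c"
  shows "inv (sigma_seq n \<sigma> c) 1 = Suc k"
proof (rule inv_f_eq)
  let ?w = "map (\<lambda>i. \<sigma> i - c) (labels n \<sigma> c)"
  have len: "length ?w = n - c" using length_labels[OF \<sigma>] by simp
  have eq: "sigma_seq n \<sigma> c i = (if i \<in> {1..n - c} then ?w ! (i - 1) else i)" for i
    unfolding sigma_seq_def delete_one_iter[OF \<sigma>] of_one_line_def part_def len ..
  have "set ?w \<subseteq> {1..n - c}"
  proof
    fix y assume "y \<in> set ?w"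
    then obtain i where i: "i \<in> {1..n}" "c < \<sigma> i" "y = \<sigma> i - c" by (auto simp: set_labels)
    then have "\<sigma> i \<le> n" using permutes_in_image[OF \<sigma>, of i] by simp
    with i show "y \<in> {1..n - c}" by auto
  qed
  moreover have "i - 1 < length ?w" if "i \<in> {1..n - c}" for i using that len by auto
  \<comment> \<open>The one-line word maps \<open>{1..n - c}\<close> into itself, so it cannot
    collide with the identity outside. This gives the injectivity needed to evaluate
    \<open>inv\<close>.\<close>
  ultimately have mem: "?w ! (i - 1) \<in> {1..n - c}" if "i \<in> {1..n - c}" for i
    using that nth_mem by blast
  have "inj_on (\<lambda>i. \<sigma> i - c) (set (labels n \<sigma> c))"
  proof (rule inj_onI)
    fix i j assume "i \<in> set (labels n \<sigma> c)" "j \<in> set (labels n \<sigma> c)" "\<sigma> i - c = \<sigma> j - c"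
    then have "\<sigma> i = \<sigma> j" by (auto simp: set_labels)
    then show "i = j" using permutes_inj[OF \<sigma>] by (simp add: inj_eq)
  qed
  then have dist: "distinct ?w" by (simp add: distinct_map distinct_labels)
  show "inj (sigma_seq n \<sigma> c)"
  proof (rule injI)
    fix i j assume ij: "sigma_seq n \<sigma> c i = sigma_seq n \<sigma> c j"
    show "i = j"
    proof (cases "i \<in> {1..n - c} \<and> j \<in> {1..n - c}")
      case True
      then have "?w ! (i - 1) = ?w ! (j - 1)" using ij unfolding eq by simp
      then have "i - 1 = j - 1"
        using nth_eq_iff_index_eq[OF dist, of "i - 1" "j - 1"] True len by auto
      then show ?thesis using True by auto
    next
      case False
      then show ?thesis using ij mem[of i] mem[of j] unfolding eq by (auto split: if_splits)
    qed
  qed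
  show "sigma_seq n \<sigma> c (Suc k) = 1"
    using sigma_seq_nth[OF \<sigma> k] assms(2) pivot(1)[OF \<sigma>, of c] k by simp
qed

text \<open>The insertion position is that of the pivot among the current labels, so inserting the
  zero amounts to extending \<open>h\<close> to the pivot by 0.\<close>

lemma insert_zero_labels:
  assumes \<sigma>: "\<sigma> permutes {1..n}" and c: "c < n" and h: "h (inv \<sigma> (Suc c)) = 0"
  shows "insert_zero (inv (sigma_seq n \<sigma> c) 1) (map h (labels n \<sigma> (Suc c))) = map h (labels n \<sigma> c)"
proof -
  let ?s = "inv \<sigma> (Suc c)"
  obtain xs ys where split: "labels n \<sigma> c = xs @ ?s # ys"
    using split_list[OF pivot(2)[OF \<sigma> c]] by blast
  have s: "inv (sigma_seq n \<sigma> c) 1 = Suc (length xs)"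
    using length_labels[OF \<sigma>, of c] split by (intro inv_sigma_seq[OF \<sigma>]) auto
  have "labels n \<sigma> (Suc c) = filter (\<lambda>i. i \<noteq> ?s) (labels n \<sigma> c)"
  proof -
    have "\<sigma> i = Suc c \<longleftrightarrow> i = ?s" for i
      using permutes_inv_eq[OF \<sigma>, of "Suc c" i] by auto
    moreover have "Suc c < \<sigma> i \<longleftrightarrow> c < \<sigma> i \<and> \<sigma> i \<noteq> Suc c" for i by linarith
    ultimately have "Suc c < \<sigma> i \<longleftrightarrow> c < \<sigma> i \<and> i \<noteq> ?s" for i by simp
    then show ?thesis unfolding labels_def filter_filter by simp
  qed
  also have "\<dots> = xs @ ys"
  proof -
    have "?s \<notin> set xs" "?s \<notin> set ys" using distinct_labels[of n \<sigma> c] unfolding split by auto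
    then have "filter (\<lambda>i. i \<noteq> ?s) xs = xs" "filter (\<lambda>i. i \<noteq> ?s) ys = ys"
      by (intro filter_True; blast)+
    then show ?thesis unfolding split by simp
  qed
  finally show ?thesis unfolding s insert_zero_def split using h by simp
qed

section \<open>The covering relation in terms of labels\<close>

lemma extendable_iff_extends:
  assumes sorted: "sorted_wrt (<) E"
    and \<tau>: "\<And>k l. k < length E \<Longrightarrow> l < length E \<Longrightarrow> \<tau> (Suc k) < \<tau> (Suc l) \<longleftrightarrow> \<sigma> (E ! k) < \<sigma> (E ! l)"
  shows "extendable \<tau> (map h E) (map g E) \<longleftrightarrow> extends (set E) \<sigma> h g"
proof -
  let ?n = "length E"
  define P where "P i j \<longleftrightarrow>
    (precedes g g i j \<longrightarrow>
        (precedes h h i j \<longrightarrow> precedes g h i j) \<and>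
        (precedes h h j i \<longrightarrow> g i = h i \<and> \<sigma> j < \<sigma> i))" for i j
  define Q where "Q i j \<longleftrightarrow>
        (g i \<ge> g j \<and> h i \<ge> h j \<longrightarrow> g j \<le> h i) \<and>
        (g i < g j \<and> h i < h j \<longrightarrow> g i < h j) \<and>
        (g i \<ge> g j \<and> h i < h j \<longrightarrow> g j = h j \<and> \<sigma> i < \<sigma> j) \<and>
        (g i < g j \<and> h i \<ge> h j \<longrightarrow> g i = h i \<and> \<sigma> i > \<sigma> j)" for i j
  \<comment> \<open>For \<open>i < j\<close> the tie-break makes one order strict and the other
    weak. The conditions with \<open>g i < g j\<close> form the pair in which \<open>i\<close> comes
    first, the other two the pair in which \<open>j\<close> does.\<close>
  have Q_iff: "Q i j \<longleftrightarrow> P i j \<and> P j i" if "i < j" for i j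
  proof -
    have iff: "precedes a b i j \<longleftrightarrow> a i < b j" "precedes a b j i \<longleftrightarrow> \<not> b i < a j" for a b
      using that by (auto simp: precedes_def)
    show ?thesis unfolding P_def Q_def iff by (simp only: not_less[symmetric]) blast
  qed
  have P_refl: "P i i" for i by (simp add: P_def precedes_def)
  have mono: "E ! k < E ! l" if "k < l" "l < ?n" for k l
    using sorted that by (simp add: sorted_wrt_iff_nth_less)
  have shift: "(\<forall>i\<in>{1..m}. R i) \<longleftrightarrow> (\<forall>k<m. R (Suc k))"
    "(\<forall>i\<in>{1..<Suc m}. R i) \<longleftrightarrow> (\<forall>k<m. R (Suc k))" for m and R :: "nat \<Rightarrow> bool"
  proof -
    have "{1..m} = Suc ` {..<m}" "{1..<Suc m} = Suc ` {..<m}"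
      by (simp_all add: image_Suc_lessThan atLeastLessThanSuc_atLeastAtMost)
    then show "(\<forall>i\<in>{1..m}. R i) \<longleftrightarrow> (\<forall>k<m. R (Suc k))"
      "(\<forall>i\<in>{1..<Suc m}. R i) \<longleftrightarrow> (\<forall>k<m. R (Suc k))" by (simp_all only: ball_simps lessThan_iff Ball_def) auto
  qed
  have part: "part (map f E) (Suc k) = f (E ! k)" if "k < ?n" for f :: "nat \<Rightarrow> nat" and k
    using that by (simp add: part_def)
  have "extendable \<tau> (map h E) (map g E) \<longleftrightarrow>
    (\<forall>k<?n. h (E ! k) \<le> g (E ! k)) \<and> (\<forall>l<?n. \<forall>k<l. Q (E ! k) (E ! l))"
    unfolding extendable_def length_map shift using part \<tau> by (auto simp: Q_def)
  also have "(\<forall>l<?n. \<forall>k<l. Q (E ! k) (E ! l)) \<longleftrightarrow> (\<forall>i\<in>set E. \<forall>j\<in>set E. P i j)"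
  proof
    assume Q: "\<forall>l<?n. \<forall>k<l. Q (E ! k) (E ! l)"
    show "\<forall>i\<in>set E. \<forall>j\<in>set E. P i j"
    proof (intro ballI)
      fix i j assume "i \<in> set E" "j \<in> set E"
      then obtain k l where "k < ?n" "i = E ! k" "l < ?n" "j = E ! l" by (auto simp: in_set_conv_nth)
      then show "P i j"
        using Q Q_iff[OF mono, of k l] Q_iff[OF mono, of l k] P_refl
        by (cases k l rule: linorder_cases) auto
    qed
  next
    assume "\<forall>i\<in>set E. \<forall>j\<in>set E. P i j"
    then show "\<forall>l<?n. \<forall>k<l. Q (E ! k) (E ! l)" using Q_iff[OF mono] by simp
  qed
  also have "(\<forall>k<?n. h (E ! k) \<le> g (E ! k)) \<longleftrightarrow> (\<forall>i\<in>set E. h i \<le> g i)"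
    by (simp add: all_set_conv_all_nth)
  finally show ?thesis unfolding extends_def P_def .
qed

lemma covered_iff_extends:
  assumes \<sigma>: "\<sigma> permutes {1..n}" and c: "c < n" and h: "h (inv \<sigma> (Suc c)) = 0"
  shows "covered n \<sigma> (map h (labels n \<sigma> (Suc c))) (map g (labels n \<sigma> c)) \<longleftrightarrow>
    extends (set (labels n \<sigma> c)) \<sigma> h g"
proof -
  have len: "length (labels n \<sigma> c) = n - c" "length (labels n \<sigma> (Suc c)) = n - Suc c"
    using length_labels[OF \<sigma>] by auto
  have k: "n - (n - Suc c) - 1 = c" using c by simp
  have "covered n \<sigma> (map h (labels n \<sigma> (Suc c))) (map g (labels n \<sigma> c)) \<longleftrightarrow>
      extendable (sigma_seq n \<sigma> c) (map h (labels n \<sigma> c)) (map g (labels n \<sigma> c))"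
    unfolding covered_def Let_def length_map len k insert_zero_labels[of \<sigma> n c h, OF \<sigma> c h] using c by auto
  also have "\<dots> \<longleftrightarrow> extends (set (labels n \<sigma> c)) \<sigma> h g"
  proof (rule extendable_iff_extends[OF sorted_labels])
    fix k l assume kl: "k < length (labels n \<sigma> c)" "l < length (labels n \<sigma> c)"
    then have "c < \<sigma> (labels n \<sigma> c ! k)" "c < \<sigma> (labels n \<sigma> c ! l)"
      using nth_mem[of _ "labels n \<sigma> c"] by (auto simp: set_labels)
    then show "sigma_seq n \<sigma> c (Suc k) < sigma_seq n \<sigma> c (Suc l) \<longleftrightarrow>
        \<sigma> (labels n \<sigma> c ! k) < \<sigma> (labels n \<sigma> c ! l)"
      using kl sigma_seq_nth[OF \<sigma>] len by auto
  qed
  finally show ?thesis .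
qed

text \<open>Inverse to mapping a function over \<open>labels\<close>. The default 0 supplies the
  inserted part at the pivot and makes the function unique.\<close>

definition label_value :: "nat \<Rightarrow> (nat \<Rightarrow> nat) \<Rightarrow> nat \<Rightarrow> nat list \<Rightarrow> nat \<Rightarrow> nat" where
  "label_value n \<sigma> c b i = (case map_of (zip (labels n \<sigma> c) b) i of None \<Rightarrow> 0 | Some v \<Rightarrow> v)"

lemma label_value_notin: "i \<notin> set (labels n \<sigma> c) \<Longrightarrow> label_value n \<sigma> c b i = 0"
  by (auto simp: label_value_def split: option.split dest!: map_of_SomeD set_zip_leftD)

lemma map_label_value:
  assumes "length b = length (labels n \<sigma> c)"
  shows "map (label_value n \<sigma> c b) (labels n \<sigma> c) = b"
  using assms
  by (intro nth_equalityI) (auto simp: label_value_def map_of_zip_nth distinct_labels)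

lemma label_value_map:
  assumes "\<And>i. i \<notin> set (labels n \<sigma> c) \<Longrightarrow> f i = 0"
  shows "label_value n \<sigma> c (map f (labels n \<sigma> c)) = f"
proof
  fix i show "label_value n \<sigma> c (map f (labels n \<sigma> c)) i = f i"
    using assms[of i] by (cases "i \<in> set (labels n \<sigma> c)")
      (auto simp: label_value_def map_of_zip_map label_value_notin)
qed

lemma word_cong:
  assumes "word L f W" "\<And>i. i \<in> L \<Longrightarrow> f i = g i"
  shows "word L g W"
proof -
  have "\<forall>p. W p \<noteq> 0 \<longrightarrow> occ W 0 p = g (W p)"
  proof (intro allI impI)
    fix p assume nz: "W p \<noteq> 0"
    show "occ W 0 p = g (W p)"
      using word_occ[OF assms(1) nz] assms(2)[OF word_mem[OF assms(1) nz]] by (rule trans)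
  qed
  moreover have "0 \<notin> L" "range W \<subseteq> insert 0 L" "\<forall>i\<in>L. \<exists>!p. W p = i" "ascent_free W"
    using assms(1) unfolding word_def by iprover+
  ultimately show ?thesis unfolding word_def by iprover
qed

lemma word_value:
  assumes "word L f W" "i \<in> L"
  shows "f i = occ W 0 (row W i)"
  using word_occ[OF assms(1), of "row W i"] word_row[OF assms] word_nonzero[OF assms] by simp

lemma word_empty: "word {} f (\<lambda>_. 0)"
  by (simp add: word_def ascent_free_def)

definition star_word :: "nat list \<Rightarrow> nat \<Rightarrow> nat" where
  "star_word a p = (if p < length (star a) then star a ! p else 0)"

subsection \<open>Tilings and chains\<close>

text \<open>\<open>X c\<close> is read on the vertical line to the right of column \<open>c\<close>,
  with \<open>X 0\<close> the left boundary. Fixing zeros from index \<open>length a\<close> on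
  encodes the right boundary and leaves one sequence per tiling.\<close>

definition layers :: "(nat \<Rightarrow> nat) \<Rightarrow> nat list \<Rightarrow> (nat \<Rightarrow> nat \<Rightarrow> nat) set" where
  "layers \<sigma> a = {X. X 0 = star_word a \<and> (\<forall>c\<ge>length a. X c = (\<lambda>_. 0)) \<and>
     (\<forall>c<length a. column (length a) \<sigma> (nrows a)
        (vert (inv \<sigma> (Suc c)) (X c) (X (Suc c))) (X c) (X (Suc c)))}"

definition layer_tiling ::
  "(nat \<Rightarrow> nat) \<Rightarrow> nat list \<Rightarrow> (nat \<Rightarrow> nat \<Rightarrow> nat) \<Rightarrow> nat \<times> nat \<Rightarrow> tile" where
  "layer_tiling \<sigma> a X = (\<lambda>(r, c)\<in>{1..nrows a} \<times> {1..length a}.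
     let v = vert (inv \<sigma> c) (X (c - 1)) (X c) in Tile (X (c - 1) (r - 1)) (v r) (v (r - 1)) (X c (r - 1)))"

definition tiling_layers :: "nat list \<Rightarrow> (nat \<times> nat \<Rightarrow> tile) \<Rightarrow> nat \<Rightarrow> nat \<Rightarrow> nat" where
  "tiling_layers a T c p =
     (if p < nrows a \<and> c < length a then tleft (T (Suc p, Suc c)) else 0)"

lemma length_star: "length (star a) = nrows a"
  using is_star_star[of a] by (simp add: is_star_def Let_def nrows_def)

lemma layer_tiling_Suc:
  assumes "p < nrows a" "c < length a"
  shows "layer_tiling \<sigma> a X (Suc p, Suc c) =
    Tile (X c p) (vert (inv \<sigma> (Suc c)) (X c) (X (Suc c)) (Suc p))
      (vert (inv \<sigma> (Suc c)) (X c) (X (Suc c)) p) (X (Suc c) p)"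
  using assms by (simp add: layer_tiling_def Let_def)

lemma ball_atLeast1_iff:
  "(\<forall>i\<in>{1..m}. P i) \<longleftrightarrow> (\<forall>k<m. P (Suc k))" "(\<forall>i\<in>{1..<m}. P i) \<longleftrightarrow> (\<forall>k. Suc k < m \<longrightarrow> P (Suc k))"
  for m :: nat
proof -
  have "i \<in> {1..m} \<longleftrightarrow> (\<exists>k<m. i = Suc k)" "i \<in> {1..<m} \<longleftrightarrow> (\<exists>k. Suc k < m \<and> i = Suc k)" for i
    by (cases i; auto)+
  then show "(\<forall>i\<in>{1..m}. P i) \<longleftrightarrow> (\<forall>k<m. P (Suc k))"
    "(\<forall>i\<in>{1..<m}. P i) \<longleftrightarrow> (\<forall>k. Suc k < m \<longrightarrow> P (Suc k))" by metis+
qed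

lemma tilings_iff:
  "T \<in> tilings \<sigma> a \<longleftrightarrow> T \<in> extensional ({1..nrows a} \<times> {1..length a}) \<and>
     (\<forall>p<nrows a. \<forall>c<length a. T (Suc p, Suc c) \<in> tiles (length a) \<sigma>) \<and>
     (\<forall>p<nrows a. \<forall>c. Suc c < length a \<longrightarrow> tright (T (Suc p, Suc c)) = tleft (T (Suc p, Suc (Suc c)))) \<and>
     (\<forall>p. Suc p < nrows a \<longrightarrow> (\<forall>c<length a. ttop (T (Suc p, Suc c)) = tbottom (T (Suc (Suc p), Suc c)))) \<and>
     (\<forall>p<nrows a. tleft (T (Suc p, 1)) = star_word a p) \<and>
     (\<forall>p<nrows a. tright (T (Suc p, length a)) = 0) \<and>
     (\<forall>c<length a. tbottom (T (1, Suc c)) = inv \<sigma> (Suc c)) \<and>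
     (\<forall>c<length a. ttop (T (nrows a, Suc c)) = 0)"
proof -
  have "T \<in> ({1..nrows a} \<times> {1..length a}) \<rightarrow>\<^sub>E tiles (length a) \<sigma> \<longleftrightarrow>
      T \<in> extensional ({1..nrows a} \<times> {1..length a}) \<and>
      (\<forall>r\<in>{1..nrows a}. \<forall>c\<in>{1..length a}. T (r, c) \<in> tiles (length a) \<sigma>)"
    unfolding PiE_def Pi_def by auto
  moreover have "part (star a) (Suc p) = star_word a p" if "p < nrows a" for p
    using that by (simp add: part_def star_word_def length_star)
  ultimately show ?thesis
    unfolding tilings_def Let_def mem_Collect_eq ball_atLeast1_iff by auto
qed

lemma layer_tiling_in_tilings:
  assumes X: "X \<in> layers \<sigma> a" and a: "length a \<ge> 1"
  shows "layer_tiling \<sigma> a X \<in> tilings \<sigma> a"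
proof -
  let ?T = "layer_tiling \<sigma> a X" and ?n = "length a" and ?R = "nrows a"
  have col: "column ?n \<sigma> ?R (vert (inv \<sigma> (Suc c)) (X c) (X (Suc c))) (X c) (X (Suc c))"
    if "c < ?n" for c using X that by (simp add: layers_def)
  have X0: "X 0 = star_word a" and Xn: "X ?n = (\<lambda>_. 0)" using X by (simp_all add: layers_def)
  obtain m where m: "?n = Suc m" using a by (cases ?n) auto
  obtain R where R: "?R = Suc R" using a by (cases ?R) (auto simp: nrows_def)
  note T = layer_tiling_Suc[of _ a _ \<sigma> X]
  have top: "vert (inv \<sigma> (Suc c)) (X c) (X (Suc c)) ?R = 0" if "c < ?n" for c
    using col[OF that] by (simp add: column_def)
  show ?thesis
    unfolding tilings_iff
  proof (intro conjI allI impI)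
    show "?T \<in> extensional ({1..?R} \<times> {1..?n})" unfolding layer_tiling_def by (rule restrict_extensional)
    show "?T (Suc p, Suc c) \<in> tiles ?n \<sigma>" if "p < ?R" "c < ?n" for p c
      using col[OF that(2)] unfolding T[OF that] column_def by blast
    show "tright (?T (Suc p, Suc c)) = tleft (?T (Suc p, Suc (Suc c)))" if "p < ?R" "Suc c < ?n" for p c
      using that by (simp add: T)
    show "ttop (?T (Suc p, Suc c)) = tbottom (?T (Suc (Suc p), Suc c))" if "Suc p < ?R" "c < ?n" for p c
      using that by (simp add: T del: vert.simps)
    show "tleft (?T (Suc p, 1)) = star_word a p" if "p < ?R" for p
      using T[OF that, of 0] m X0 by simp
    show "tright (?T (Suc p, ?n)) = 0" if "p < ?R" for p
      using T[OF that, of m] m Xn by simp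
    show "tbottom (?T (1, Suc c)) = inv \<sigma> (Suc c)" if "c < ?n" for c
      using T[OF _ that, of 0] R by simp
    show "ttop (?T (?R, Suc c)) = 0" if "c < ?n" for c
      using T[OF _ that, of R] R top[OF that] by (simp del: vert.simps)
  qed
qed

text \<open>Outside the grid the edges default to 0, in agreement with the top and right boundaries,
  so the padding consists of zero tiles. Inside, the vertical labels of the tiling must be those of
  \<open>vert\<close>.\<close>

lemma tiling_layers_column:
  assumes T: "T \<in> tilings \<sigma> a" and a: "length a \<ge> 1" and c: "c < length a"
  defines "X \<equiv> tiling_layers a T"
  defines "v \<equiv> vert (inv \<sigma> (Suc c)) (X c) (X (Suc c))"
  shows "column (length a) \<sigma> (nrows a) v (X c) (X (Suc c))"
    and "p < nrows a \<Longrightarrow> T (Suc p, Suc c) = Tile (X c p) (v (Suc p)) (v p) (X (Suc c) p)"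
proof -
  let ?n = "length a" and ?R = "nrows a"
  note T' = T[unfolded tilings_iff]
  have mem: "T (Suc p, Suc c) \<in> tiles ?n \<sigma>" if "p < ?R" for p using T' that c by blast
  have horizontal: "tright (T (Suc p, Suc c)) = tleft (T (Suc p, Suc (Suc c)))"
    if "p < ?R" "Suc c < ?n" for p using T' that by blast
  have vertical: "ttop (T (Suc p, Suc c)) = tbottom (T (Suc (Suc p), Suc c))" if "Suc p < ?R" for p
    using T' that c by blast
  have right: "tright (T (Suc p, ?n)) = 0" if "p < ?R" for p using T' that by blast
  have bottom: "tbottom (T (1, Suc c)) = inv \<sigma> (Suc c)" using T' c by blast
  have top: "ttop (T (?R, Suc c)) = 0" using T' c by blast
  define u where "u p = (if p < ?R then tbottom (T (Suc p, Suc c)) else 0)" for p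
  have left: "X c p = (if p < ?R then tleft (T (Suc p, Suc c)) else 0)" for p
    using c by (simp add: X_def tiling_layers_def)
  have right': "X (Suc c) p = (if p < ?R then tright (T (Suc p, Suc c)) else 0)" for p
  proof (cases "Suc c < ?n")
    case True
    then show ?thesis using horizontal by (simp add: X_def tiling_layers_def)
  next
    case False
    then have "Suc c = ?n" using c by simp
    then show ?thesis using right by (simp add: X_def tiling_layers_def)
  qed
  have top': "u (Suc p) = ttop (T (Suc p, Suc c))" if "p < ?R" for p
  proof (cases "Suc p < ?R")
    case True
    then show ?thesis using vertical by (simp add: u_def)
  next
    case False
    then have "Suc p = ?R" using that by simp
    then show ?thesis using top by (simp add: u_def)
  qed
  have eq: "T (Suc p, Suc c) = Tile (X c p) (u (Suc p)) (u p) (X (Suc c) p)" if "p < ?R" for p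
    using that left right' top' by (intro tile.expand) (simp add: u_def)
  have tile: "Tile (X c p) (u (Suc p)) (u p) (X (Suc c) p) \<in> tiles ?n \<sigma>" for p
  proof (cases "p < ?R")
    case True
    then show ?thesis using mem eq by simp
  next
    case False
    then show ?thesis by (simp add: left right' u_def tiles.intros)
  qed
  have "0 < ?R" using a unfolding nrows_def by linarith
  then have "u 0 = inv \<sigma> (Suc c)"
    using bottom by (simp add: u_def)
  then have "u p = v p" for p
    using column_eq_vert[of p "X c" u "X (Suc c)", OF tile] unfolding v_def by (rule subst)
  then have "u = v" ..
  moreover have "u p = 0" if "p \<ge> ?R" for p using that by (simp add: u_def)
  ultimately show "column ?n \<sigma> ?R v (X c) (X (Suc c))"
    using tile unfolding column_def by blast
  show "p < nrows a \<Longrightarrow> T (Suc p, Suc c) = Tile (X c p) (v (Suc p)) (v p) (X (Suc c) p)"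
    using eq \<open>u = v\<close> by simp
qed

lemma tiling_layers_in_layers:
  assumes T: "T \<in> tilings \<sigma> a" and a: "length a \<ge> 1"
  shows "tiling_layers a T \<in> layers \<sigma> a"
proof -
  have "tiling_layers a T 0 = star_word a"
  proof
    fix p
    have "tleft (T (Suc p, Suc 0)) = star_word a p" if "p < nrows a"
      using T that unfolding tilings_iff by simp
    then show "tiling_layers a T 0 p = star_word a p"
      using a by (auto simp: tiling_layers_def star_word_def length_star)
  qed
  moreover have "tiling_layers a T c = (\<lambda>_. 0)" if "c \<ge> length a" for c
    using that by (simp add: tiling_layers_def fun_eq_iff)
  ultimately show ?thesis
    using tiling_layers_column(1)[OF T a] by (simp add: layers_def)
qed

lemma bij_betw_layers_tilings:
  assumes a: "length a \<ge> 1"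
  shows "bij_betw (layer_tiling \<sigma> a) (layers \<sigma> a) (tilings \<sigma> a)"
proof (rule bij_betw_byWitness[where f' = "tiling_layers a"])
  show "layer_tiling \<sigma> a ` layers \<sigma> a \<subseteq> tilings \<sigma> a"
    using layer_tiling_in_tilings[OF _ a] by blast
  show "tiling_layers a ` tilings \<sigma> a \<subseteq> layers \<sigma> a"
    using tiling_layers_in_layers[OF _ a] by blast
  show "\<forall>X\<in>layers \<sigma> a. tiling_layers a (layer_tiling \<sigma> a X) = X"
  proof (intro ballI ext)
    fix X c p assume X: "X \<in> layers \<sigma> a"
    show "tiling_layers a (layer_tiling \<sigma> a X) c p = X c p"
    proof (cases "c < length a")
      case True
      then have "column (length a) \<sigma> (nrows a)
        (vert (inv \<sigma> (Suc c)) (X c) (X (Suc c))) (X c) (X (Suc c))"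
        using X by (simp add: layers_def)
      then show ?thesis
        using True column_zero(1) by (cases "p < nrows a") (simp_all add: tiling_layers_def layer_tiling_Suc)
    next
      case False
      then show ?thesis using X by (simp add: layers_def tiling_layers_def)
    qed
  qed
  show "\<forall>T\<in>tilings \<sigma> a. layer_tiling \<sigma> a (tiling_layers a T) = T"
  proof
    fix T assume T: "T \<in> tilings \<sigma> a"
    show "layer_tiling \<sigma> a (tiling_layers a T) = T"
    proof (rule extensionalityI[of _ "{1..nrows a} \<times> {1..length a}"])
      show "layer_tiling \<sigma> a (tiling_layers a T) \<in> extensional ({1..nrows a} \<times> {1..length a})"
        unfolding layer_tiling_def by (rule restrict_extensional)
      show "T \<in> extensional ({1..nrows a} \<times> {1..length a})" using T unfolding tilings_iff by blast
      fix rc assume "rc \<in> {1..nrows a} \<times> {1..length a}"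
      then obtain p c where "rc = (Suc p, Suc c)" "p < nrows a" "c < length a"
        by (cases rc; cases "fst rc"; cases "snd rc") auto
      then show "layer_tiling \<sigma> a (tiling_layers a T) rc = T rc"
        using tiling_layers_column(2)[OF T a] layer_tiling_Suc by simp
    qed
  qed
qed

lemma tiling_weight_layer_tiling:
  fixes x :: "nat \<Rightarrow> 'a::comm_ring_1"
  assumes X: "X \<in> layers \<sigma> a"
  shows "tiling_weight a x (layer_tiling \<sigma> a X) =
    (\<Prod>c<length a. x (Suc c) ^
       (\<Sum>p<nrows a. of_bool (X c p = 0 \<and> vert (inv \<sigma> (Suc c)) (X c) (X (Suc c)) p \<noteq> 0)))"
proof -
  let ?n = "length a" and ?R = "nrows a" and ?T = "layer_tiling \<sigma> a X"
  let ?v = "\<lambda>c. vert (inv \<sigma> (Suc c)) (X c) (X (Suc c))"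
  have weight: "tile_weight ?n x (Suc c) (?T (Suc p, Suc c)) =
      x (Suc c) ^ of_bool (X c p = 0 \<and> ?v c p \<noteq> 0)" if "p < ?R" "c < ?n" for p c
  proof -
    have tile: "Tile (X c p) (?v c (Suc p)) (?v c p) (X (Suc c) p) \<in> tiles ?n \<sigma>"
      using X that(2) unfolding layers_def column_def by blast
    then have "(\<exists>i\<in>{1..?n}. Tile (X c p) (?v c (Suc p)) (?v c p) (X (Suc c) p) = Tile 0 i i 0) \<longleftrightarrow>
        X c p = 0 \<and> ?v c p \<noteq> 0"
      unfolding Tile_in_tiles_iff by (auto simp del: vert.simps)
    then show ?thesis
      unfolding tile_weight_def layer_tiling_Suc[OF that] by simp
  qed
  have "tiling_weight a x ?T = (\<Prod>r\<in>{1..?R}. \<Prod>c\<in>{1..?n}. tile_weight ?n x c (?T (r, c)))"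
    unfolding tiling_weight_def prod.cartesian_product ..
  also have "\<dots> = (\<Prod>c\<in>{1..?n}. \<Prod>r\<in>{1..?R}. tile_weight ?n x c (?T (r, c)))"
    by (rule prod.swap)
  also have "\<dots> = (\<Prod>c<?n. \<Prod>p<?R. tile_weight ?n x (Suc c) (?T (Suc p, Suc c)))"
    by (simp add: prod.atLeast1_atMost_eq)
  also have "\<dots> = (\<Prod>c<?n. \<Prod>p<?R. x (Suc c) ^ of_bool (X c p = 0 \<and> ?v c p \<noteq> 0))"
    using weight by (intro prod.cong) auto
  finally show ?thesis unfolding power_sum .
qed

lemma label_value_0:
  assumes \<sigma>: "\<sigma> permutes {1..n}" and a: "length a = n" and i: "i \<in> {1..n}"
  shows "label_value n \<sigma> 0 a i = part a i"
proof -
  have len: "length (labels n \<sigma> 0) = n" using length_labels[OF \<sigma>, of 0] by simp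
  have nth: "labels n \<sigma> 0 ! (i - 1) = i" using i unfolding labels_0[OF \<sigma>] by (simp del: upt_Suc)
  have "map (label_value n \<sigma> 0 a) (labels n \<sigma> 0) ! (i - 1) = a ! (i - 1)"
    using map_label_value[of a n \<sigma> 0] a len by simp
  moreover have "i - 1 < length (labels n \<sigma> 0)" using i len by auto
  ultimately show ?thesis by (simp only: nth_map nth part_def)
qed

lemma set_labels_0:
  assumes "\<sigma> permutes {1..n}"
  shows "set (labels n \<sigma> 0) = {1..n}"
  unfolding labels_0[OF assms] by auto

lemma set_labels_n:
  assumes "\<sigma> permutes {1..n}"
  shows "set (labels n \<sigma> n) = {}"
  using length_labels[OF assms, of n] by simp

section \<open>Sequences of words as chains of compositions\<close>

text \<open>Two inductions: from the right boundary leftwards to exclude bad ascents, then from the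
  string rightwards to apply \<open>column_word\<close> to each column.\<close>

lemma layers_words:
  assumes \<sigma>: "\<sigma> permutes {1..length a}" and X: "X \<in> layers \<sigma> a"
  obtains g where
    "map (g 0) (labels (length a) \<sigma> 0) = a"
    "\<And>c. c \<le> length a \<Longrightarrow> word (set (labels (length a) \<sigma> c)) (g c) (X c)"
    "\<And>c i. i \<notin> set (labels (length a) \<sigma> c) \<Longrightarrow> g c i = 0"
    "\<And>c. c < length a \<Longrightarrow> extends (set (labels (length a) \<sigma> c)) \<sigma> (g (Suc c)) (g c)"
proof -
  let ?n = "length a"
  let ?L = "\<lambda>c. set (labels ?n \<sigma> c)"
  have col: "column ?n \<sigma> (nrows a) (vert (inv \<sigma> (Suc c)) (X c) (X (Suc c))) (X c) (X (Suc c))"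
    if "c < ?n" for c using X that by (simp add: layers_def)
  have X0: "X 0 = star_word a" and Xn: "X ?n = (\<lambda>_. 0)" using X by (simp_all add: layers_def)
  \<comment> \<open>The final zero word has no bad ascent, and a column would pass one on to its
    right.\<close>
  have good: "\<not> bad_ascent \<sigma> (X c)" if "c \<le> ?n" for c
    using that
  proof (induction c rule: inc_induct)
    case base
    show ?case by (simp add: bad_ascent_def Xn)
  next
    case (step c)
    then show ?case using column_bad_ascent[OF col[of c]] by blast
  qed
  define g where "g c i = (if i \<in> ?L c then occ (X c) 0 (row (X c) i) else 0)" for c i
  have g_eq: "g c i = f i" if "word (?L c) f (X c)" "i \<in> ?L c" for c f i
    using word_value[OF that] that(2) by (simp add: g_def)
  have 0: "word (?L 0) (part a) (X 0)"
    unfolding X0 set_labels_0[OF \<sigma>] using word_star[of a] by (simp add: star_word_def[abs_def])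
  have step: "word (?L (Suc c)) (g (Suc c)) (X (Suc c)) \<and> extends (?L c) \<sigma> (g (Suc c)) (g c)"
    if c: "c < ?n" and w: "word (?L c) (g c) (X c)" for c
  proof -
    let ?s = "inv \<sigma> (Suc c)"
    \<comment> \<open>Any ascent created by this column would be bad.\<close>
    have af: "ascent_free (X (Suc c))"
      using column_ascent_bad[OF col[OF c] word_ascent_free[OF w]] good[of "Suc c"] c by auto
    have "\<sigma> ?s < \<sigma> i" if "i \<in> ?L c" "i \<noteq> ?s" for i
      using pivot(1)[OF \<sigma> c] pivot(3)[OF \<sigma> c] that set_labels[of ?n \<sigma> "Suc c"] by auto
    then obtain b where b: "word (?L c - {?s}) b (X (Suc c))" "\<And>i. i \<notin> ?L c - {?s} \<Longrightarrow> b i = 0"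
      "extends (?L c) \<sigma> b (g c)"
      using column_word[OF col[OF c] w af] pivot(2)[OF \<sigma> c] by auto
    have "g (Suc c) i = b i" for i
    proof (cases "i \<in> ?L (Suc c)")
      case True
      then show ?thesis using g_eq b(1) pivot(3)[OF \<sigma> c] by metis
    next
      case False
      then have "g (Suc c) i = 0" by (simp add: g_def)
      moreover have "i \<notin> ?L c - {?s}" using False unfolding pivot(3)[OF \<sigma> c] .
      then have "b i = 0" by (rule b(2))
      ultimately show ?thesis by simp
    qed
    then have "g (Suc c) = b" ..
    then show ?thesis using b pivot(3)[OF \<sigma> c] by simp
  qed
  have w: "word (?L c) (g c) (X c)" if "c \<le> ?n" for c
    using that
  proof (induction c)
    case 0
    show ?case using word_cong[OF \<open>word (?L 0) (part a) (X 0)\<close>] g_eq[OF \<open>word (?L 0) (part a) (X 0)\<close>]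
      by simp
  next
    case (Suc c)
    then show ?case using step by simp
  qed
  have "map (g 0) (labels ?n \<sigma> 0) = map (part a) [1..<Suc ?n]"
    unfolding labels_0[OF \<sigma>, symmetric] using g_eq[OF 0] by simp
  also have "\<dots> = a" by (intro nth_equalityI) (auto simp: part_def simp del: upt_Suc)
  finally show ?thesis using w step by (intro that[of g]) (auto simp: g_def)
qed

definition chain_layers :: "(nat \<Rightarrow> nat) \<Rightarrow> nat list \<Rightarrow> nat list list \<Rightarrow> nat \<Rightarrow> nat \<Rightarrow> nat" where
  "chain_layers \<sigma> a bs c = (if c < length a
     then THE W. word (set (labels (length a) \<sigma> c)) (label_value (length a) \<sigma> c ((a # bs) ! c)) W
     else (\<lambda>_. 0))"

lemma word_chain_layers:
  assumes \<sigma>: "\<sigma> permutes {1..length a}" and c: "c \<le> length a"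
  shows "word (set (labels (length a) \<sigma> c)) (label_value (length a) \<sigma> c ((a # bs) ! c)) (chain_layers \<sigma> a bs c)"
proof (cases "c < length a")
  case True
  have "0 \<notin> set (labels (length a) \<sigma> c)" by (simp add: set_labels)
  then obtain W where
    W: "word (set (labels (length a) \<sigma> c)) (label_value (length a) \<sigma> c ((a # bs) ! c)) W"
    using ex_word[OF finite_set] by blast
  then have "(THE W. word (set (labels (length a) \<sigma> c)) (label_value (length a) \<sigma> c ((a # bs) ! c)) W) = W"
    by (intro the_equality) (auto dest: word_unique)
  then show ?thesis using True W by (simp add: chain_layers_def)
next
  case False
  then show ?thesis using c set_labels_n[OF \<sigma>] by (simp add: chain_layers_def word_empty)
qed

lemma chain_length:
  assumes bs: "bs \<in> covering_chains (length a) \<sigma> a" and "c \<le> length a"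
  shows "length ((a # bs) ! c) = length a - c"
  using assms(2)
proof (induction c)
  case (Suc c)
  then have "Suc c \<in> {1..length a}" by simp
  then have "covered (length a) \<sigma> ((a # bs) ! Suc c) ((a # bs) ! (Suc c - 1))"
    using bs unfolding covering_chains_def by blast
  then have "length ((a # bs) ! c) = Suc (length ((a # bs) ! Suc c))" by (simp add: covered_def)
  then show ?case using Suc by simp
qed simp

lemma chain_label_value:
  assumes "\<sigma> permutes {1..length a}" "bs \<in> covering_chains (length a) \<sigma> a" "c \<le> length a"
  shows "map (label_value (length a) \<sigma> c ((a # bs) ! c)) (labels (length a) \<sigma> c) = (a # bs) ! c"
  using chain_length[OF assms(2,3)] length_labels[OF assms(1), of c] by (intro map_label_value) simp

lemma chain_layers_in_layers:
  assumes \<sigma>: "\<sigma> permutes {1..length a}" and bs: "bs \<in> covering_chains (length a) \<sigma> a"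
    and a: "length a \<ge> 1"
  shows "chain_layers \<sigma> a bs \<in> layers \<sigma> a"
proof -
  let ?n = "length a" and ?X = "chain_layers \<sigma> a bs" and ?N = "nrows a"
  let ?g = "\<lambda>c. label_value ?n \<sigma> c ((a # bs) ! c)"
  note w = word_chain_layers[OF \<sigma>]
  have X0: "?X 0 = star_word a"
  proof (rule word_unique)
    show "word (set (labels ?n \<sigma> 0)) (?g 0) (?X 0)" using w[of 0] by simp
    have "part a i = ?g 0 i" if "i \<in> {1..?n}" for i
      using label_value_0[OF \<sigma> refl that] by simp
    then have "word {1..?n} (?g 0) (star_word a)"
      using word_cong[of "{1..?n}" "part a" "star_word a" "?g 0"] word_star[of a]
      by (simp add: star_word_def[abs_def])
    then show "word (set (labels ?n \<sigma> 0)) (?g 0) (star_word a)"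
      unfolding set_labels_0[OF \<sigma>] .
  qed
  \<comment> \<open>The vanishing of the left word above the grid is assumed here; it holds for the
    string, and \<open>column_zero\<close> passes it to the next word, so an induction on
    \<open>c\<close> below supplies it.\<close>
  have step: "column ?n \<sigma> ?N (vert (inv \<sigma> (Suc c)) (?X c) (?X (Suc c))) (?X c) (?X (Suc c))"
    if c: "c < ?n" and zero: "\<And>p. p \<ge> ?N \<Longrightarrow> ?X c p = 0" for c
  proof (rule extends_column[where L = "set (labels ?n \<sigma> c)"])
    show "word (set (labels ?n \<sigma> c)) (?g c) (?X c)" using w[of c] c by simp
    show "word (set (labels ?n \<sigma> c) - {inv \<sigma> (Suc c)}) (?g (Suc c)) (?X (Suc c))"
      using w[of "Suc c"] c pivot(3)[OF \<sigma> c] by simp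
    show "inv \<sigma> (Suc c) \<in> set (labels ?n \<sigma> c)" using pivot(2)[OF \<sigma> c] .
    show g0: "?g (Suc c) (inv \<sigma> (Suc c)) = 0"
      using pivot(3)[OF \<sigma> c] by (intro label_value_notin) simp
    show "set (labels ?n \<sigma> c) \<subseteq> {1..?n}" by (auto simp: set_labels)
    have "Suc c \<in> {1..?n}" using c by simp
    then have "covered ?n \<sigma> ((a # bs) ! Suc c) ((a # bs) ! (Suc c - 1))"
      using bs unfolding covering_chains_def by blast
    then have "covered ?n \<sigma> (map (?g (Suc c)) (labels ?n \<sigma> (Suc c))) (map (?g c) (labels ?n \<sigma> c))"
      using chain_label_value[OF \<sigma> bs, of c] chain_label_value[OF \<sigma> bs, of "Suc c"] c by simp
    then show "extends (set (labels ?n \<sigma> c)) \<sigma> (?g (Suc c)) (?g c)"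
      unfolding covered_iff_extends[of \<sigma> ?n c "?g (Suc c)", OF \<sigma> c g0] .
    show "\<sigma> (inv \<sigma> (Suc c)) < \<sigma> i" if "i \<in> set (labels ?n \<sigma> c)" "i \<noteq> inv \<sigma> (Suc c)" for i
      using pivot(1)[OF \<sigma> c] pivot(3)[OF \<sigma> c] that set_labels[of ?n \<sigma> "Suc c"] by auto
  qed (use zero in auto)
  have zero: "?X c p = 0" if "c \<le> ?n" "p \<ge> ?N" for c p
    using that
  proof (induction c arbitrary: p)
    case 0
    then show ?case using X0 by (simp add: star_word_def length_star)
  next
    case (Suc c)
    then show ?case using column_zero(2)[OF step[of c]] by simp
  qed
  have "?X c = (\<lambda>_. 0)" if "c \<ge> ?n" for c using that by (simp add: chain_layers_def)
  then show ?thesis using X0 step zero by (simp add: layers_def)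
qed

text \<open>A word determines its composition through its zero counts, which gives injectivity. For
  surjectivity, \<open>layers_words\<close> provides the chain, and uniqueness of words returns the
  given sequence.\<close>

lemma bij_betw_chains_layers:
  assumes \<sigma>: "\<sigma> permutes {1..length a}" and a: "length a \<ge> 1"
  shows "bij_betw (chain_layers \<sigma> a) (covering_chains (length a) \<sigma> a) (layers \<sigma> a)"
  unfolding bij_betw_def
proof (intro conjI equalityI image_subsetI)
  let ?n = "length a"
  let ?L = "\<lambda>c. set (labels ?n \<sigma> c)"
  show "chain_layers \<sigma> a bs \<in> layers \<sigma> a" if "bs \<in> covering_chains ?n \<sigma> a" for bs
    using chain_layers_in_layers[OF \<sigma> that a] .
  show "inj_on (chain_layers \<sigma> a) (covering_chains ?n \<sigma> a)"
  proof (rule inj_onI)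
    fix bs bs' assume bs: "bs \<in> covering_chains ?n \<sigma> a" and bs': "bs' \<in> covering_chains ?n \<sigma> a"
      and eq: "chain_layers \<sigma> a bs = chain_layers \<sigma> a bs'"
    have nth: "(a # bs) ! c = (a # bs') ! c" if c: "c \<le> ?n" for c
    proof -
      have "label_value ?n \<sigma> c ((a # bs) ! c) i = label_value ?n \<sigma> c ((a # bs') ! c) i" if "i \<in> ?L c" for i
        using word_value[OF word_chain_layers[OF \<sigma> c, of bs] that]
          word_value[OF word_chain_layers[OF \<sigma> c, of bs'] that] eq by simp
      then have "map (label_value ?n \<sigma> c ((a # bs) ! c)) (labels ?n \<sigma> c) =
        map (label_value ?n \<sigma> c ((a # bs') ! c)) (labels ?n \<sigma> c)" by simp
      then show ?thesis unfolding chain_label_value[OF \<sigma> bs c] chain_label_value[OF \<sigma> bs' c] .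
    qed
    have "length bs = ?n" "length bs' = ?n" using bs bs' by (simp_all add: covering_chains_def)
    then show "bs = bs'" using nth[of "Suc c" for c] by (intro nth_equalityI) simp_all
  qed
  show "layers \<sigma> a \<subseteq> chain_layers \<sigma> a ` covering_chains ?n \<sigma> a"
  proof
    fix X assume X: "X \<in> layers \<sigma> a"
    show "X \<in> chain_layers \<sigma> a ` covering_chains ?n \<sigma> a"
    proof (rule layers_words[OF \<sigma> X])
      fix g assume g: "map (g 0) (labels ?n \<sigma> 0) = a"
        "\<And>c. c \<le> ?n \<Longrightarrow> word (?L c) (g c) (X c)"
        "\<And>c i. i \<notin> ?L c \<Longrightarrow> g c i = 0"
        "\<And>c. c < ?n \<Longrightarrow> extends (?L c) \<sigma> (g (Suc c)) (g c)"
      define bs where "bs = map (\<lambda>c. map (g c) (labels ?n \<sigma> c)) [1..<Suc ?n]"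
      have nth: "(a # bs) ! c = map (g c) (labels ?n \<sigma> c)" if "c \<le> ?n" for c
        using that g(1) by (cases c) (simp_all add: bs_def nth_upt del: upt_Suc)
      have "bs \<in> covering_chains ?n \<sigma> a"
      proof -
        have "covered ?n \<sigma> ((a # bs) ! i) ((a # bs) ! (i - 1))" if i: "i \<in> {1..?n}" for i
        proof -
          obtain c where c: "i = Suc c" "c < ?n" using i by (cases i) auto
          have "g (Suc c) (inv \<sigma> (Suc c)) = 0" using g(3) pivot(3)[OF \<sigma> c(2)] by simp
          then show ?thesis
            using covered_iff_extends[of \<sigma> ?n c "g (Suc c)" "g c", OF \<sigma> c(2)] g(4)[OF c(2)] nth[of c] nth[of "Suc c"] c
            by simp
        qed
        moreover have "length bs = ?n" by (simp add: bs_def del: upt_Suc)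
        ultimately show ?thesis unfolding covering_chains_def by blast
      qed
      moreover have "chain_layers \<sigma> a bs = X"
      proof
        fix c
        show "chain_layers \<sigma> a bs c = X c"
        proof (cases "c \<le> ?n")
          case True
          have "label_value ?n \<sigma> c ((a # bs) ! c) = g c"
            unfolding nth[OF True] using g(3) by (rule label_value_map)
          then show ?thesis
            using word_unique[OF word_chain_layers[OF \<sigma> True, of bs]] g(2)[OF True] by simp
        next
          case False
          then show ?thesis using X by (simp add: layers_def chain_layers_def)
        qed
      qed
      ultimately show ?thesis by blast
    qed
  qed
qed

text \<open>\<open>column_weight\<close> expresses each size as the next one plus the exponent, so
  the natural-number subtraction is not truncated.\<close>

lemma chain_weight:
  fixes x :: "nat \<Rightarrow> 'a::comm_ring_1"
  assumes \<sigma>: "\<sigma> permutes {1..length a}" and bs: "bs \<in> covering_chains (length a) \<sigma> a"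
    and a: "length a \<ge> 1"
  shows "tiling_weight a x (layer_tiling \<sigma> a (chain_layers \<sigma> a bs)) =
    (\<Prod>i\<in>{1..length a}. x i ^ (sum_list ((a # bs) ! (i - 1)) - sum_list ((a # bs) ! i)))"
proof -
  let ?n = "length a" and ?X = "chain_layers \<sigma> a bs"
  let ?g = "\<lambda>c. label_value ?n \<sigma> c ((a # bs) ! c)"
  have X: "?X \<in> layers \<sigma> a" using chain_layers_in_layers[OF \<sigma> bs a] .
  have sum: "sum_list ((a # bs) ! c) = sum (?g c) (set (labels ?n \<sigma> c))" if "c \<le> ?n" for c
  proof -
    have "sum_list ((a # bs) ! c) = sum_list (map (?g c) (labels ?n \<sigma> c))"
      unfolding chain_label_value[OF \<sigma> bs that] ..
    then show ?thesis by (simp only: sum_list_distinct_conv_sum_set[OF distinct_labels])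
  qed
  have weight: "(\<Sum>p<nrows a. of_bool (?X c p = 0 \<and> vert (inv \<sigma> (Suc c)) (?X c) (?X (Suc c)) p \<noteq> 0)) =
      sum_list ((a # bs) ! c) - sum_list ((a # bs) ! Suc c)" if c: "c < ?n" for c
  proof -
    have "column ?n \<sigma> (nrows a) (vert (inv \<sigma> (Suc c)) (?X c) (?X (Suc c))) (?X c) (?X (Suc c))"
      "vert (inv \<sigma> (Suc c)) (?X c) (?X (Suc c)) 0 \<noteq> 0"
      using X c pivot(2)[OF \<sigma> c] by (simp_all add: layers_def set_labels)
    note sum_eq = column_weight[OF this word_chain_layers[OF \<sigma> less_imp_le[OF c], of bs]
        word_chain_layers[OF \<sigma> Suc_leI[OF c], of bs]]
    show ?thesis
      unfolding sum[OF less_imp_le[OF c]] sum[OF Suc_leI[OF c]] sum_eq by (rule diff_add_inverse[symmetric])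
  qed
  have "tiling_weight a x (layer_tiling \<sigma> a ?X) =
      (\<Prod>c<?n. x (Suc c) ^ (sum_list ((a # bs) ! c) - sum_list ((a # bs) ! Suc c)))"
    unfolding tiling_weight_layer_tiling[OF X] using weight by (intro prod.cong) simp_all
  then show ?thesis by (simp add: prod.atLeast1_atMost_eq)
qed

theorem theorem4p4:
  fixes n :: nat and \<sigma> :: "nat \<Rightarrow> nat" and \<alpha> :: "nat list" and x :: "nat \<Rightarrow> 'a::comm_ring_1"
  assumes "n \<ge> 1"
    and "\<sigma> permutes {1..n}"
    and "length \<alpha> = n"
  shows "partition_function \<sigma> \<alpha> x =
    (\<Sum>bs\<in>covering_chains n \<sigma> \<alpha>.
       \<Prod>i\<in>{1..n}. x i ^ (sum_list ((\<alpha> # bs) ! (i - 1)) - sum_list ((\<alpha> # bs) ! i)))"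
proof -
  have \<sigma>: "\<sigma> permutes {1..length \<alpha>}" and \<alpha>: "length \<alpha> \<ge> 1" using assms by simp_all
  have "partition_function \<sigma> \<alpha> x = (\<Sum>X\<in>layers \<sigma> \<alpha>. tiling_weight \<alpha> x (layer_tiling \<sigma> \<alpha> X))"
    unfolding partition_function_def
    by (rule sum.reindex_bij_betw[OF bij_betw_layers_tilings[OF \<alpha>], symmetric])
  also have "\<dots> = (\<Sum>bs\<in>covering_chains (length \<alpha>) \<sigma> \<alpha>.
      tiling_weight \<alpha> x (layer_tiling \<sigma> \<alpha> (chain_layers \<sigma> \<alpha> bs)))"
    by (rule sum.reindex_bij_betw[OF bij_betw_chains_layers[OF \<sigma> \<alpha>], symmetric])
  finally show ?thesis using chain_weight[OF \<sigma> _ \<alpha>, where x = x] assms(3) by simp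
qed

end
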